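(* Let $G$ be an asymmetric digraph. Then the chain complexes of $R$-modules $\Pi_*(G)$ and $\Omega_*(G)$ are naturally isomorphic.
   Context: Fix a commutative ring $R$ with unit. A digraph $G=(V_G,E_G)$ is a finite nonempty set $V_G$ of vertices with a set $E_G$ of ordered pairs $(v,w)$ of distinct vertices, written $v\to w$ (arrows). $G$ is asymmetric if there are no $v,w$ with both $v\to w$ and $w\to v$ in $E_G$. For a finite set $V$ and $n\ge 0$, $\Lambda_n(V)$ is the free $R$-module with basis the elements $e_{i_0\dots i_n}$, one for each sequence $(i_0,\dots,i_n)$ of elements of $V$ (elementary $n$-paths); $\Lambda_{-1}(V)=0$. The differential $\partial\colon\Lambda_n(V)\to\Lambda_{n-1}(V)$ is $\partial(e_{i_0\dots i_n})=\sum_{m=0}^n(-1)^m e_{i_0\dots\widehat{i_m}\dots i_n}$ for $n\ge1$, and $\partial=0$ for $n=0$. An elementary path is irregular if it has two equal consecutive vertices, regular otherwise. For $n\ge 1$, $I_n(V)\subset\Lambda_n(V)$ is the submodule generated by irregular elementary paths; $I_0=I_{-1}=0$. One has $\partial(I_n)\subset I_{n-1}$, so $\mathcal R_n(V)=\Lambda_n(V)/I_n(V)$ is a chain complex with the induced differential, again denoted $\partial$. An elementary path $e_{i_0\dots i_n}$ in $V_G$ is allowed if $(i_k\to i_{k+1})\in E_G$ for all $0\le k\le n-1$ (every $e_{i_0}$ is allowed). $\mathcal A_n(G)\subset\Lambda_n(V_G)$ is the submodule generated by allowed elementary $n$-paths; $\mathcal A_{-1}(G)=0$. Since allowed paths are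 regular, $\mathcal A_n(G)$ is also identified with a submodule of $\mathcal R_n(V_G)$ via $e_{i_0\dots i_n}\mapsto[e_{i_0\dots i_n}]$. $\Pi_n(G)=\{w\in\mathcal A_n(G)\mid\partial w\in\mathcal A_{n-1}(G)\}$ with $\partial$ the differential of $\Lambda_*(V_G)$; $\Pi_{-1}=0$. $\Omega_n(G)=\{w\in\mathcal A_n(G)\mid\partial w\in\mathcal A_{n-1}(G)\}$ with $\partial$ the differential of $\mathcal R_*(V_G)$; $\Omega_{-1}=0$. Both are chain complexes with the restricted differentials. A digraph map $f\colon G\to H$ is a map $V_G\to V_H$ such that for each $(v\to w)\in E_G$ either $f(v)=f(w)$ or $(f(v)\to f(w))\in E_H$. For asymmetric digraphs it induces chain maps $\Pi_*(G)\to\Pi_*(H)$ and $\Omega_*(G)\to\Omega_*(H)$, both given on elementary paths by $e_{i_0\dots i_n}\mapsto e_{f(i_0)\dots f(i_n)}$ if the latter is regular and by $0$ otherwise. *)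

theory Defs
  imports "Graph_Theory.Pair_Digraph" "HOL-Algebra.Module" "HOL-Algebra.AbelCoset"
begin

section \<open>Modules over a commutative ring\<close>

definition linear_maps ::
  "('r, 'x) ring_scheme \<Rightarrow> ('r, 'a) module \<Rightarrow> ('r, 'b) module \<Rightarrow> ('a \<Rightarrow> 'b) set" where
  "linear_maps R M N = {h \<in> carrier M \<rightarrow> carrier N.
     (\<forall>x\<in>carrier M. \<forall>y\<in>carrier M. h (x \<oplus>\<^bsub>M\<^esub> y) = h x \<oplus>\<^bsub>N\<^esub> h y) \<and>
     (\<forall>a\<in>carrier R. \<forall>x\<in>carrier M. h (a \<odot>\<^bsub>M\<^esub> x) = a \<odot>\<^bsub>N\<^esub> h x)}"

definition generated_submodule ::
  "('r, 'x) ring_scheme \<Rightarrow> ('r, 'a) module \<Rightarrow> 'a set \<Rightarrow> 'a set" where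
  "generated_submodule R M S = (\<lambda>N. submodule N R M) hull S"

text \<open>The ring fields \<open>mult\<close> and \<open>one\<close> inherited by the record type of modules
  play no role for modules and are left unspecified.\<close>

definition quotient_module :: "('r, 'a) module \<Rightarrow> 'a set \<Rightarrow> ('r, 'a set) module" where
  "quotient_module M N =
     \<lparr>carrier = a_rcosets\<^bsub>M\<^esub> N, mult = undefined, one = undefined,
      zero = N, add = set_add M,
      smult = (\<lambda>a X. \<Union>x\<in>X. N +>\<^bsub>M\<^esub> (a \<odot>\<^bsub>M\<^esub> x))\<rparr>"

text \<open>The map into \<open>quotient_module M' N'\<close> induced on cosets by a map \<open>h\<close> into \<open>M'\<close>:
  if \<open>h\<close> is linear and maps \<open>N\<close> into \<open>N'\<close>, then all members of the union are the same
  coset, and \<open>N +> x\<close> is mapped to \<open>N' +> h x\<close>.\<close>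

definition quotient_map ::
  "('r, 'b) module \<Rightarrow> 'b set \<Rightarrow> ('a \<Rightarrow> 'b) \<Rightarrow> 'a set \<Rightarrow> 'b set" where
  "quotient_map M' N' h X = (\<Union>x\<in>X. N' +>\<^bsub>M'\<^esub> h x)"

definition free_module :: "('r, 'x) ring_scheme \<Rightarrow> 'b set \<Rightarrow> ('r, 'b \<Rightarrow> 'r) module" where
  "free_module R B =
     \<lparr>carrier = {c. range c \<subseteq> carrier R \<and> finite {b. c b \<noteq> \<zero>\<^bsub>R\<^esub>} \<and> (\<forall>b. b \<notin> B \<longrightarrow> c b = \<zero>\<^bsub>R\<^esub>)},
      mult = undefined, one = undefined,
      zero = (\<lambda>b. \<zero>\<^bsub>R\<^esub>), add = (\<lambda>c d b. c b \<oplus>\<^bsub>R\<^esub> d b),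
      smult = (\<lambda>a c b. a \<otimes>\<^bsub>R\<^esub> c b)\<rparr>"

definition basis_elem :: "('r, 'x) ring_scheme \<Rightarrow> 'b \<Rightarrow> 'b \<Rightarrow> 'r" where
  "basis_elem R b = (\<lambda>b'. if b' = b then \<one>\<^bsub>R\<^esub> else \<zero>\<^bsub>R\<^esub>)"

text \<open>The linear map from a free module to \<open>M\<close> given on the basis by \<open>g\<close>.\<close>

definition linear_extension ::
  "('r, 'x) ring_scheme \<Rightarrow> ('r, 'a) module \<Rightarrow> ('b \<Rightarrow> 'a) \<Rightarrow> ('b \<Rightarrow> 'r) \<Rightarrow> 'a" where
  "linear_extension R M g c = (\<Oplus>\<^bsub>M\<^esub>b\<in>{b. c b \<noteq> \<zero>\<^bsub>R\<^esub>}. c b \<odot>\<^bsub>M\<^esub> g b)"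


section \<open>Chain complexes\<close>

record ('r, 'a) complex_data =
  chains :: "int \<Rightarrow> ('r, 'a) module"
  diff :: "int \<Rightarrow> 'a \<Rightarrow> 'a"

definition chain_complex :: "('r, 'x) ring_scheme \<Rightarrow> ('r, 'a) complex_data \<Rightarrow> bool" where
  "chain_complex R C \<longleftrightarrow>
     (\<forall>n. module R (chains C n)) \<and>
     (\<forall>n. diff C n \<in> linear_maps R (chains C n) (chains C (n - 1))) \<and>
     (\<forall>n. \<forall>x\<in>carrier (chains C n). diff C (n - 1) (diff C n x) = \<zero>\<^bsub>chains C (n - 2)\<^esub>)"

definition chain_map ::
  "('r, 'x) ring_scheme \<Rightarrow> ('r, 'a) complex_data \<Rightarrow> ('r, 'b) complex_data
    \<Rightarrow> (int \<Rightarrow> 'a \<Rightarrow> 'b) \<Rightarrow> bool" where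
  "chain_map R C D \<phi> \<longleftrightarrow>
     (\<forall>n. \<phi> n \<in> linear_maps R (chains C n) (chains D n)) \<and>
     (\<forall>n. \<forall>x\<in>carrier (chains C n). diff D n (\<phi> n x) = \<phi> (n - 1) (diff C n x))"

definition chain_isomorphism ::
  "('r, 'x) ring_scheme \<Rightarrow> ('r, 'a) complex_data \<Rightarrow> ('r, 'b) complex_data
    \<Rightarrow> (int \<Rightarrow> 'a \<Rightarrow> 'b) \<Rightarrow> bool" where
  "chain_isomorphism R C D \<phi> \<longleftrightarrow> chain_map R C D \<phi> \<and>
     (\<forall>n. bij_betw (\<phi> n) (carrier (chains C n)) (carrier (chains D n)))"


section \<open>Asymmetric digraphs\<close>

definition asymmetric_digraph :: "'v pair_pre_digraph \<Rightarrow> bool" where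
  "asymmetric_digraph G \<longleftrightarrow> pair_digraph G \<and> pverts G \<noteq> {} \<and> asym (parcs G)"

definition digraph_map ::
  "'v pair_pre_digraph \<Rightarrow> 'v pair_pre_digraph \<Rightarrow> ('v \<Rightarrow> 'v) \<Rightarrow> bool" where
  "digraph_map G H f \<longleftrightarrow> f ` pverts G \<subseteq> pverts H \<and>
     (\<forall>(v, w)\<in>parcs G. f v = f w \<or> (f v, f w) \<in> parcs H)"

text \<open>Functors from the category of asymmetric digraphs to chain complexes, given by
  their action \<open>F\<close> on objects and \<open>F'\<close> on morphisms. The category consists of the
  digraphs whose vertices are taken from the (arbitrary) type \<open>'v\<close>. Maps out of a
  digraph or a chain module are only considered on the vertex set or carrier.\<close>

definition digraph_functor ::
  "('r, 'x) ring_scheme \<Rightarrow> ('v pair_pre_digraph \<Rightarrow> ('r, 'a) complex_data)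
    \<Rightarrow> ('v pair_pre_digraph \<Rightarrow> 'v pair_pre_digraph \<Rightarrow> ('v \<Rightarrow> 'v) \<Rightarrow> int \<Rightarrow> 'a \<Rightarrow> 'a) \<Rightarrow> bool" where
  "digraph_functor R F F' \<longleftrightarrow>
     (\<forall>G. asymmetric_digraph G \<longrightarrow> chain_complex R (F G)) \<and>
     (\<forall>G H f. asymmetric_digraph G \<and> asymmetric_digraph H \<and> digraph_map G H f \<longrightarrow>
        chain_map R (F G) (F H) (F' G H f)) \<and>
     (\<forall>G n. asymmetric_digraph G \<longrightarrow> (\<forall>x\<in>carrier (chains (F G) n). F' G G id n x = x)) \<and>
     (\<forall>G H K f g. asymmetric_digraph G \<and> asymmetric_digraph H \<and> asymmetric_digraph K \<and>
        digraph_map G H f \<and> digraph_map H K g \<longrightarrow>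
        (\<forall>n. \<forall>x\<in>carrier (chains (F G) n). F' G K (g \<circ> f) n x = F' H K g n (F' G H f n x)))"

definition naturally_isomorphic ::
  "('r, 'x) ring_scheme \<Rightarrow> ('v pair_pre_digraph \<Rightarrow> ('r, 'a) complex_data)
    \<Rightarrow> ('v pair_pre_digraph \<Rightarrow> 'v pair_pre_digraph \<Rightarrow> ('v \<Rightarrow> 'v) \<Rightarrow> int \<Rightarrow> 'a \<Rightarrow> 'a)
    \<Rightarrow> ('v pair_pre_digraph \<Rightarrow> ('r, 'b) complex_data)
    \<Rightarrow> ('v pair_pre_digraph \<Rightarrow> 'v pair_pre_digraph \<Rightarrow> ('v \<Rightarrow> 'v) \<Rightarrow> int \<Rightarrow> 'b \<Rightarrow> 'b) \<Rightarrow> bool" where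
  "naturally_isomorphic R F F' E E' \<longleftrightarrow>
     digraph_functor R F F' \<and> digraph_functor R E E' \<and>
     (\<exists>\<theta>. (\<forall>G. asymmetric_digraph G \<longrightarrow> chain_isomorphism R (F G) (E G) (\<theta> G)) \<and>
          (\<forall>G H f. asymmetric_digraph G \<and> asymmetric_digraph H \<and> digraph_map G H f \<longrightarrow>
             (\<forall>n. \<forall>x\<in>carrier (chains (F G) n).
                \<theta> H n (F' G H f n x) = E' G H f n (\<theta> G n x))))"


section \<open>Paths\<close>

text \<open>An elementary \<open>n\<close>-path is a list of \<open>n + 1\<close> vertices. Degrees are integers; since the
  empty list is excluded, there are no elementary paths of degree \<open>-1\<close> or below.\<close>

definition elem_paths :: "'v set \<Rightarrow> int \<Rightarrow> 'v list set" where
  "elem_paths V n = {p. p \<noteq> [] \<and> set p \<subseteq> V \<and> int (length p) = n + 1}"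

definition path_module ::
  "('r, 'x) ring_scheme \<Rightarrow> 'v set \<Rightarrow> int \<Rightarrow> ('r, 'v list \<Rightarrow> 'r) module" where
  "path_module R V n = free_module R (elem_paths V n)"

definition del_nth :: "nat \<Rightarrow> 'v list \<Rightarrow> 'v list" where
  "del_nth m p = take m p @ drop (Suc m) p"

definition boundary ::
  "('r, 'x) ring_scheme \<Rightarrow> 'v set \<Rightarrow> int \<Rightarrow> ('v list \<Rightarrow> 'r) \<Rightarrow> ('v list \<Rightarrow> 'r)" where
  "boundary R V n = linear_extension R (path_module R V (n - 1))
     (\<lambda>p. if n \<ge> 1
          then \<Oplus>\<^bsub>path_module R V (n - 1)\<^esub>m\<in>{0..nat n}.
                 ((\<ominus>\<^bsub>R\<^esub> \<one>\<^bsub>R\<^esub>) [^]\<^bsub>R\<^esub> m) \<odot>\<^bsub>path_module R V (n - 1)\<^esub> basis_elem R (del_nth m p)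
          else \<zero>\<^bsub>path_module R V (n - 1)\<^esub>)"

text \<open>Regularity of a path, i.e. the absence of equal consecutive vertices, is
  \<^const>\<open>distinct_adj\<close>.\<close>

definition irregular_submodule ::
  "('r, 'x) ring_scheme \<Rightarrow> 'v set \<Rightarrow> int \<Rightarrow> ('v list \<Rightarrow> 'r) set" where
  "irregular_submodule R V n = generated_submodule R (path_module R V n)
     (basis_elem R ` {p \<in> elem_paths V n. \<not> distinct_adj p})"

definition regular_module ::
  "('r, 'x) ring_scheme \<Rightarrow> 'v set \<Rightarrow> int \<Rightarrow> ('r, ('v list \<Rightarrow> 'r) set) module" where
  "regular_module R V n = quotient_module (path_module R V n) (irregular_submodule R V n)"

definition regular_class ::
  "('r, 'x) ring_scheme \<Rightarrow> 'v set \<Rightarrow> int \<Rightarrow> ('v list \<Rightarrow> 'r) \<Rightarrow> ('v list \<Rightarrow> 'r) set" where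
  "regular_class R V n w = irregular_submodule R V n +>\<^bsub>path_module R V n\<^esub> w"

definition regular_boundary ::
  "('r, 'x) ring_scheme \<Rightarrow> 'v set \<Rightarrow> int \<Rightarrow> ('v list \<Rightarrow> 'r) set \<Rightarrow> ('v list \<Rightarrow> 'r) set" where
  "regular_boundary R V n = quotient_map (path_module R V (n - 1))
     (irregular_submodule R V (n - 1)) (boundary R V n)"


section \<open>The complexes of allowed paths\<close>

definition allowed_paths :: "'v pair_pre_digraph \<Rightarrow> int \<Rightarrow> 'v list set" where
  "allowed_paths G n =
     {p \<in> elem_paths (pverts G) n. successively (\<lambda>v w. (v, w) \<in> parcs G) p}"

definition allowed_submodule ::
  "('r, 'x) ring_scheme \<Rightarrow> 'v pair_pre_digraph \<Rightarrow> int \<Rightarrow> ('v list \<Rightarrow> 'r) set" where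
  "allowed_submodule R G n = generated_submodule R (path_module R (pverts G) n)
     (basis_elem R ` allowed_paths G n)"

definition Pi_carrier ::
  "('r, 'x) ring_scheme \<Rightarrow> 'v pair_pre_digraph \<Rightarrow> int \<Rightarrow> ('v list \<Rightarrow> 'r) set" where
  "Pi_carrier R G n =
     {w \<in> allowed_submodule R G n. boundary R (pverts G) n w \<in> allowed_submodule R G (n - 1)}"

definition Pi_complex ::
  "('r, 'x) ring_scheme \<Rightarrow> 'v pair_pre_digraph \<Rightarrow> ('r, 'v list \<Rightarrow> 'r) complex_data" where
  "Pi_complex R G =
     \<lparr>chains = (\<lambda>n. (path_module R (pverts G) n)\<lparr>carrier := Pi_carrier R G n\<rparr>),
      diff = boundary R (pverts G)\<rparr>"

definition Omega_carrier ::
  "('r, 'x) ring_scheme \<Rightarrow> 'v pair_pre_digraph \<Rightarrow> int \<Rightarrow> ('v list \<Rightarrow> 'r) set set" where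
  "Omega_carrier R G n =
     {X \<in> regular_class R (pverts G) n ` allowed_submodule R G n.
        regular_boundary R (pverts G) n X
          \<in> regular_class R (pverts G) (n - 1) ` allowed_submodule R G (n - 1)}"

definition Omega_complex ::
  "('r, 'x) ring_scheme \<Rightarrow> 'v pair_pre_digraph \<Rightarrow> ('r, ('v list \<Rightarrow> 'r) set) complex_data" where
  "Omega_complex R G =
     \<lparr>chains = (\<lambda>n. (regular_module R (pverts G) n)\<lparr>carrier := Omega_carrier R G n\<rparr>),
      diff = regular_boundary R (pverts G)\<rparr>"


section \<open>Induced maps\<close>

definition Pi_map ::
  "('r, 'x) ring_scheme \<Rightarrow> 'v pair_pre_digraph \<Rightarrow> 'v pair_pre_digraph \<Rightarrow> ('v \<Rightarrow> 'v)
    \<Rightarrow> int \<Rightarrow> ('v list \<Rightarrow> 'r) \<Rightarrow> ('v list \<Rightarrow> 'r)" where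
  "Pi_map R G H f n = linear_extension R (path_module R (pverts H) n)
     (\<lambda>p. if distinct_adj (map f p) then basis_elem R (map f p)
          else \<zero>\<^bsub>path_module R (pverts H) n\<^esub>)"

text \<open>If a path \<open>p\<close> is irregular, then so is \<open>map f p\<close>; hence the linear extension
  vanishes on irregular paths and passes to the quotients.\<close>

definition Omega_map ::
  "('r, 'x) ring_scheme \<Rightarrow> 'v pair_pre_digraph \<Rightarrow> 'v pair_pre_digraph \<Rightarrow> ('v \<Rightarrow> 'v)
    \<Rightarrow> int \<Rightarrow> ('v list \<Rightarrow> 'r) set \<Rightarrow> ('v list \<Rightarrow> 'r) set" where
  "Omega_map R G H f n = quotient_map (path_module R (pverts H) n)
     (irregular_submodule R (pverts H) n) (Pi_map R G H f n)"

end

(* Deleting a vertex from an allowed path of an asymmetric digraph never produces an irregular path,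
   because two arrows u -> v -> u cannot both occur. Hence the boundary of an allowed chain is
   supported on regular paths. The chains supported on regular paths meet the irregular chains only
   in 0, so for allowed chains the conditions defining Pi and Omega coincide, and passing to classes
   modulo irregular paths is an isomorphism. It commutes with induced maps because both are induced
   by the same linear map on chains of paths. That Omega is a functor is then inherited from Pi. *)
theory Submission
  imports Defs
begin

section \<open>Linear maps\<close>

text \<open>Two obstacles shape the proof. On the complex of all paths, the induced map that kills
  irregular images is in general not a chain map: if \<open>f\<close> sends a path to a regular path
  u v u, taking the boundary last leaves the irregular face u u, while taking it first loses that
  face. The chain map equation is therefore proved on allowed chains only, with an asymmetric
  target, and the facts on free modules are phrased for the span of a subset \<open>A\<close> of the
  basis \<open>B\<close>. The other obstacle is that the chains of Omega are cosets, on which module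
  axioms and functor laws would be tedious to check. But all these laws are equations, and the class
  map is a surjection compatible with every operation, so each law is checked on representatives in
  Pi. What is used about the boundary comes down to three facts on alternating sums over the faces
  of one list: they commute with linear maps, the iterated sum vanishes, and the regular faces of an
  irregular list cancel.\<close>

lemma linear_mapsI:
  assumes "\<And>x. x \<in> carrier M \<Longrightarrow> h x \<in> carrier N"
    and "\<And>x y. \<lbrakk>x \<in> carrier M; y \<in> carrier M\<rbrakk> \<Longrightarrow> h (x \<oplus>\<^bsub>M\<^esub> y) = h x \<oplus>\<^bsub>N\<^esub> h y"
    and "\<And>a x. \<lbrakk>a \<in> carrier R; x \<in> carrier M\<rbrakk> \<Longrightarrow> h (a \<odot>\<^bsub>M\<^esub> x) = a \<odot>\<^bsub>N\<^esub> h x"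
  shows "h \<in> linear_maps R M N"
  using assms by (auto simp: linear_maps_def)

lemma
  assumes "h \<in> linear_maps R M N"
  shows linear_maps_closed: "x \<in> carrier M \<Longrightarrow> h x \<in> carrier N"
    and linear_maps_add:
      "\<lbrakk>x \<in> carrier M; y \<in> carrier M\<rbrakk> \<Longrightarrow> h (x \<oplus>\<^bsub>M\<^esub> y) = h x \<oplus>\<^bsub>N\<^esub> h y"
    and linear_maps_smult:
      "\<lbrakk>a \<in> carrier R; x \<in> carrier M\<rbrakk> \<Longrightarrow> h (a \<odot>\<^bsub>M\<^esub> x) = a \<odot>\<^bsub>N\<^esub> h x"
  using assms by (auto simp: linear_maps_def)

lemma linear_maps_zero:
  assumes "module R M" "module R N" "h \<in> linear_maps R M N"
  shows "h \<zero>\<^bsub>M\<^esub> = \<zero>\<^bsub>N\<^esub>"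
proof -
  interpret M: module R M by fact
  interpret N: module R N by fact
  have "h \<zero>\<^bsub>M\<^esub> = h (\<zero>\<^bsub>R\<^esub> \<odot>\<^bsub>M\<^esub> \<zero>\<^bsub>M\<^esub>)"
    by simp
  also have "\<dots> = \<zero>\<^bsub>R\<^esub> \<odot>\<^bsub>N\<^esub> h \<zero>\<^bsub>M\<^esub>"
    by (rule linear_maps_smult[OF assms(3)]) auto
  also have "\<dots> = \<zero>\<^bsub>N\<^esub>"
    using linear_maps_closed[OF assms(3)] by simp
  finally show ?thesis .
qed

lemma linear_maps_comp:
  assumes "h \<in> linear_maps R M N" "k \<in> linear_maps R N L"
  shows "(\<lambda>x. k (h x)) \<in> linear_maps R M L"
  using assms by (auto simp: linear_maps_def Pi_iff)

lemma (in module) submoduleI':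
  assumes "H \<subseteq> carrier M" "\<zero>\<^bsub>M\<^esub> \<in> H"
    and "\<And>x y. \<lbrakk>x \<in> H; y \<in> H\<rbrakk> \<Longrightarrow> x \<oplus>\<^bsub>M\<^esub> y \<in> H"
    and smult: "\<And>a x. \<lbrakk>a \<in> carrier R; x \<in> H\<rbrakk> \<Longrightarrow> a \<odot>\<^bsub>M\<^esub> x \<in> H"
  shows "submodule H R M"
proof (rule submoduleI)
  show "\<ominus>\<^bsub>M\<^esub> x \<in> H" if "x \<in> H" for x
    using smult[of "\<ominus> \<one>" x] smult_l_minus[of \<one> x] that assms(1) by auto
qed (use assms in auto)

lemma (in module) submodule_zero_closed:
  "submodule H R M \<Longrightarrow> \<zero>\<^bsub>M\<^esub> \<in> H"
  using subgroup.one_closed[of H "add_monoid M"] by (simp add: submodule_def)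

text \<open>Every element of \<open>N\<close> is some \<open>h x\<close>, so each axiom is inherited
  from \<open>M\<close>. The zero of the record \<open>N\<close> is not yet known to be neutral,
  hence preservation of zero is a hypothesis here and cannot be taken from
  \<open>linear_maps_zero\<close>.\<close>

lemma module_linear_image:
  assumes M: "module R M" and "h ` carrier M = carrier N" and zero: "h \<zero>\<^bsub>M\<^esub> = \<zero>\<^bsub>N\<^esub>"
    and h: "h \<in> linear_maps R M N"
  shows "module R N"
proof -
  interpret M: module R M by fact
  note add = linear_maps_add[OF h, symmetric] and smult = linear_maps_smult[OF h, symmetric]
  have closed: "h x \<in> carrier N" if "x \<in> carrier M" for x
    using assms(2) that by auto
  have lift: "P y" if "y \<in> carrier N" "\<And>x. x \<in> carrier M \<Longrightarrow> P (h x)" for P y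
    using that assms(2) by (metis imageE)
  show ?thesis
  proof (rule moduleI)
    show "abelian_group N"
    proof (rule abelian_groupI)
      show "x \<oplus>\<^bsub>N\<^esub> y \<in> carrier N" if x: "x \<in> carrier N" and y: "y \<in> carrier N" for x y
        by (rule lift[OF x], rule lift[OF y]) (simp add: add closed)
      show "x \<oplus>\<^bsub>N\<^esub> y = y \<oplus>\<^bsub>N\<^esub> x" if x: "x \<in> carrier N" and y: "y \<in> carrier N" for x y
        by (rule lift[OF x], rule lift[OF y]) (simp add: add M.a_comm)
      show "(x \<oplus>\<^bsub>N\<^esub> y) \<oplus>\<^bsub>N\<^esub> z = x \<oplus>\<^bsub>N\<^esub> (y \<oplus>\<^bsub>N\<^esub> z)"
        if x: "x \<in> carrier N" and y: "y \<in> carrier N" and z: "z \<in> carrier N" for x y z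
        by (rule lift[OF x], rule lift[OF y], rule lift[OF z]) (simp add: add M.a_assoc)
      show "\<zero>\<^bsub>N\<^esub> \<oplus>\<^bsub>N\<^esub> x = x" if x: "x \<in> carrier N" for x
        unfolding zero[symmetric] by (rule lift[OF x]) (simp add: add)
      show "\<exists>y\<in>carrier N. y \<oplus>\<^bsub>N\<^esub> x = \<zero>\<^bsub>N\<^esub>" if x: "x \<in> carrier N" for x
      proof (rule lift[OF x])
        show "\<exists>y\<in>carrier N. y \<oplus>\<^bsub>N\<^esub> h u = \<zero>\<^bsub>N\<^esub>" if "u \<in> carrier M" for u
          using that by (intro bexI[of _ "h (\<ominus>\<^bsub>M\<^esub> u)"])
            (simp_all add: add closed M.l_neg zero)
      qed
      show "\<zero>\<^bsub>N\<^esub> \<in> carrier N"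
        using closed[OF M.zero_closed] zero by simp
    qed
    fix a x
    assume a: "a \<in> carrier R" and x: "x \<in> carrier N"
    show "a \<odot>\<^bsub>N\<^esub> x \<in> carrier N"
      by (rule lift[OF x]) (simp add: a smult closed)
    show "(a \<oplus>\<^bsub>R\<^esub> b) \<odot>\<^bsub>N\<^esub> x = a \<odot>\<^bsub>N\<^esub> x \<oplus>\<^bsub>N\<^esub> b \<odot>\<^bsub>N\<^esub> x" if "b \<in> carrier R" for b
      by (rule lift[OF x]) (simp add: a that smult add M.smult_l_distr)
    show "a \<odot>\<^bsub>N\<^esub> (x \<oplus>\<^bsub>N\<^esub> y) = a \<odot>\<^bsub>N\<^esub> x \<oplus>\<^bsub>N\<^esub> a \<odot>\<^bsub>N\<^esub> y" if y: "y \<in> carrier N" for y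
      by (rule lift[OF x], rule lift[OF y]) (simp add: a smult add M.smult_r_distr)
    show "a \<otimes>\<^bsub>R\<^esub> b \<odot>\<^bsub>N\<^esub> x = a \<odot>\<^bsub>N\<^esub> (b \<odot>\<^bsub>N\<^esub> x)" if "b \<in> carrier R" for b
      by (rule lift[OF x]) (simp add: a that smult M.smult_assoc1)
  next
    show "\<one>\<^bsub>R\<^esub> \<odot>\<^bsub>N\<^esub> x = x" if x: "x \<in> carrier N" for x
      by (rule lift[OF x]) (simp add: smult)
  qed (rule M.R.is_cring)
qed


section \<open>Free modules\<close>

context cring
begin

lemma basis_elem_closed: "b \<in> B \<Longrightarrow> basis_elem R b \<in> carrier (free_module R B)"
  by (auto simp: free_module_def basis_elem_def)

lemma free_module_carrier_mono:
  "A \<subseteq> B \<Longrightarrow> carrier (free_module R A) \<subseteq> carrier (free_module R B)"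
  by (auto simp: free_module_def)

lemma free_module_add_closed:
  assumes "c \<in> carrier (free_module R B)" "d \<in> carrier (free_module R B)"
  shows "c \<oplus>\<^bsub>free_module R B\<^esub> d \<in> carrier (free_module R B)"
proof -
  have "{b. c b \<oplus> d b \<noteq> \<zero>} \<subseteq> {b. c b \<noteq> \<zero>} \<union> {b. d b \<noteq> \<zero>}"
    by auto
  then show ?thesis
    using assms by (auto simp: free_module_def range_subsetD intro: finite_subset)
qed

lemma free_module_smult_closed:
  assumes "a \<in> carrier R" "c \<in> carrier (free_module R B)"
  shows "a \<odot>\<^bsub>free_module R B\<^esub> c \<in> carrier (free_module R B)"
proof -
  have "{b. a \<otimes> c b \<noteq> \<zero>} \<subseteq> {b. c b \<noteq> \<zero>}"
    using assms by auto
  then show ?thesis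
    using assms by (auto simp: free_module_def range_subsetD intro: finite_subset)
qed

lemma module_free_module: "module R (free_module R B)"
proof (rule moduleI)
  show "abelian_group (free_module R B)"
  proof (rule abelian_groupI)
    show "\<exists>d\<in>carrier (free_module R B). d \<oplus>\<^bsub>free_module R B\<^esub> c = \<zero>\<^bsub>free_module R B\<^esub>"
      if "c \<in> carrier (free_module R B)" for c
    proof
      show "(\<ominus> \<one>) \<odot>\<^bsub>free_module R B\<^esub> c \<in> carrier (free_module R B)"
        by (rule free_module_smult_closed) (use that in auto)
      show "(\<ominus> \<one>) \<odot>\<^bsub>free_module R B\<^esub> c \<oplus>\<^bsub>free_module R B\<^esub> c = \<zero>\<^bsub>free_module R B\<^esub>"
        using that by (auto simp: free_module_def range_subsetD l_minus l_neg)
    qed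
  qed (fact free_module_add_closed | auto simp: free_module_def range_subsetD a_ac)+
qed (fact free_module_smult_closed is_cring
    | auto simp: free_module_def range_subsetD l_distr r_distr m_assoc)+

text \<open>The operations of \<open>free_module\<close> do not mention the basis set, so cutting
  the carrier down to functions supported on \<open>A\<close> gives literally
  \<open>free_module R A\<close>.\<close>

lemma submodule_free_module:
  assumes "A \<subseteq> B"
  shows "submodule (carrier (free_module R A)) R (free_module R B)"
proof -
  interpret M: module R "free_module R B" by (rule module_free_module)
  have "free_module R B\<lparr>carrier := carrier (free_module R A)\<rparr> = free_module R A"
    by (simp add: free_module_def)
  then show ?thesis
    using module_free_module[of A] free_module_carrier_mono[OF assms]
    by (intro M.module_incl_imp_submodule) simp_all
qed

lemma free_module_induct [consumes 1, case_names zero add smult]: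
  assumes "c \<in> carrier (free_module R B)"
    and zero: "P \<zero>\<^bsub>free_module R B\<^esub>"
    and add: "\<And>c d. \<lbrakk>c \<in> carrier (free_module R B); d \<in> carrier (free_module R B); P c; P d\<rbrakk>
      \<Longrightarrow> P (c \<oplus>\<^bsub>free_module R B\<^esub> d)"
    and smult: "\<And>a b. \<lbrakk>a \<in> carrier R; b \<in> B\<rbrakk> \<Longrightarrow> P (a \<odot>\<^bsub>free_module R B\<^esub> basis_elem R b)"
  shows "P c"
proof -
  \<comment> \<open>Induction over a finite superset \<open>S\<close> of the support, not over the
    support itself: one point can then be dropped from \<open>S\<close> even if \<open>c\<close>
    vanishes there or the point lies outside \<open>B\<close>.\<close>
  have "P c" if "finite S" "c \<in> carrier (free_module R B)" "{b. c b \<noteq> \<zero>} \<subseteq> S" for S c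
    using that
  proof (induction S arbitrary: c)
    case empty
    then have "c = \<zero>\<^bsub>free_module R B\<^esub>"
      by (auto simp: free_module_def)
    then show ?case using zero by simp
  next
    case (insert b S)
    show ?case
    proof (cases "b \<in> B")
      case False
      then have "c b = \<zero>" using insert.prems by (simp add: free_module_def)
      then have "{b. c b \<noteq> \<zero>} \<subseteq> S" using insert.prems(2) by blast
      then show ?thesis by (rule insert.IH[OF insert.prems(1)])
    next
      case True
      let ?d = "c(b := \<zero>)"
      have "finite {x. ?d x \<noteq> \<zero>}"
        by (rule finite_subset[of _ "{x. c x \<noteq> \<zero>}"])
          (use insert.prems(1) in \<open>auto simp: free_module_def\<close>)
      then have d: "?d \<in> carrier (free_module R B)"
        using insert.prems(1) by (auto simp: free_module_def)
      have cb: "c b \<in> carrier R" and c: "\<And>x. c x \<in> carrier R"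
        using insert.prems by (auto simp: free_module_def)
      have c_eq: "c = c b \<odot>\<^bsub>free_module R B\<^esub> basis_elem R b \<oplus>\<^bsub>free_module R B\<^esub> ?d"
        using c by (auto simp: free_module_def basis_elem_def fun_eq_iff)
      show ?thesis
      proof (subst c_eq, rule add)
        show "P ?d" using insert.prems by (intro insert.IH d) auto
      qed (intro free_module_smult_closed basis_elem_closed smult cb True d)+
    qed
  qed
  then show ?thesis using assms(1) by (auto simp: free_module_def)
qed

text \<open>This turns the generated submodules of the definitions into conditions on supports: a
  chain lies in the span of \<open>A\<close> iff it vanishes off \<open>A\<close>.\<close>

lemma generated_submodule_basis:
  assumes "A \<subseteq> B"
  shows "generated_submodule R (free_module R B) (basis_elem R ` A) = carrier (free_module R A)"
  unfolding generated_submodule_def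
proof
  interpret M: module R "free_module R B" by (rule module_free_module)
  show "(\<lambda>N. submodule N R (free_module R B)) hull basis_elem R ` A \<subseteq> carrier (free_module R A)"
    using basis_elem_closed submodule_free_module[OF assms] by (intro hull_minimal) auto
  have "c \<in> N" if "submodule N R (free_module R B)" "basis_elem R ` A \<subseteq> N"
    "c \<in> carrier (free_module R A)" for N c
    using that(3)
  proof (induction rule: free_module_induct)
    case zero
    then show ?case
      using M.submodule_zero_closed[OF that(1)] by (simp add: free_module_def)
  next
    case (add c d)
    then show ?case
      using M.submoduleE(5)[OF that(1)] by (simp add: free_module_def)
  next
    case (smult a b)
    then show ?case
      using M.submoduleE(4)[OF that(1), of a "basis_elem R b"] that(2)
      by (auto simp: free_module_def)
  qed
  then show "carrier (free_module R A) \<subseteq> (\<lambda>N. submodule N R (free_module R B)) hull basis_elem R ` A"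
    by (auto simp: hull_def)
qed

section \<open>Linear extension from a basis\<close>

context
  fixes M :: "('a, 'c) module" and B :: "'d set" and g :: "'d \<Rightarrow> 'c"
  assumes M: "module R M" and g: "\<And>b. b \<in> B \<Longrightarrow> g b \<in> carrier M"
begin

interpretation M: module R M by (rule M)

text \<open>The sum in \<open>linear_extension\<close> runs over the support of its argument.
  Additivity needs one index set common to \<open>c\<close>, \<open>d\<close> and their sum, whose
  support may shrink by cancellation.\<close>

lemma linear_extension_superset:
  assumes "c \<in> carrier (free_module R B)" "finite S" "S \<subseteq> B" "{b. c b \<noteq> \<zero>} \<subseteq> S"
  shows "linear_extension R M g c = (\<Oplus>\<^bsub>M\<^esub>b\<in>S. c b \<odot>\<^bsub>M\<^esub> g b)"
  unfolding linear_extension_def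
proof (rule M.M.add.finprod_mono_neutral_cong_left)
  show "(\<lambda>b. c b \<odot>\<^bsub>M\<^esub> g b) \<in> S \<rightarrow> carrier M"
    using assms g by (fastforce simp: free_module_def)
qed (use assms g in auto)

lemma linear_extension_linear: "linear_extension R M g \<in> linear_maps R (free_module R B) M"
proof (rule linear_mapsI)
  have supp: "finite {b. c b \<noteq> \<zero>}" "{b. c b \<noteq> \<zero>} \<subseteq> B" "\<And>b. c b \<in> carrier R"
    if "c \<in> carrier (free_module R B)" for c
    using that by (auto simp: free_module_def)
  have in_carrier: "(\<lambda>b. c b \<odot>\<^bsub>M\<^esub> g b) \<in> S \<rightarrow> carrier M"
    if "c \<in> carrier (free_module R B)" "S \<subseteq> B" for c S
    using that g by (fastforce simp: free_module_def)
  show "linear_extension R M g c \<in> carrier M" if "c \<in> carrier (free_module R B)" for c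
    unfolding linear_extension_def using in_carrier[OF that supp(2)[OF that]] by (rule M.M.finsum_closed)
  show "linear_extension R M g (c \<oplus>\<^bsub>free_module R B\<^esub> d) =
      linear_extension R M g c \<oplus>\<^bsub>M\<^esub> linear_extension R M g d"
    if c: "c \<in> carrier (free_module R B)" and d: "d \<in> carrier (free_module R B)" for c d
  proof -
    let ?S = "{b. c b \<noteq> \<zero>} \<union> {b. d b \<noteq> \<zero>}"
    have S: "finite ?S" "?S \<subseteq> B" using supp c d by auto
    have "linear_extension R M g (c \<oplus>\<^bsub>free_module R B\<^esub> d) =
        (\<Oplus>\<^bsub>M\<^esub>b\<in>?S. (c \<oplus>\<^bsub>free_module R B\<^esub> d) b \<odot>\<^bsub>M\<^esub> g b)"
      using S by (intro linear_extension_superset free_module_add_closed c d)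
        (auto simp: free_module_def)
    also have "\<dots> = (\<Oplus>\<^bsub>M\<^esub>b\<in>?S. c b \<odot>\<^bsub>M\<^esub> g b \<oplus>\<^bsub>M\<^esub> d b \<odot>\<^bsub>M\<^esub> g b)"
    proof (rule M.M.finsum_cong')
      show "(c \<oplus>\<^bsub>free_module R B\<^esub> d) b \<odot>\<^bsub>M\<^esub> g b = c b \<odot>\<^bsub>M\<^esub> g b \<oplus>\<^bsub>M\<^esub> d b \<odot>\<^bsub>M\<^esub> g b"
        if "b \<in> ?S" for b
        using that S(2) supp(3)[OF c] supp(3)[OF d] g
        by (subst M.smult_l_distr[symmetric]) (auto simp: free_module_def)
    qed (use S in_carrier[OF c, of ?S] in_carrier[OF d, of ?S] in \<open>auto simp: Pi_iff\<close>)
    also have "\<dots> = (\<Oplus>\<^bsub>M\<^esub>b\<in>?S. c b \<odot>\<^bsub>M\<^esub> g b) \<oplus>\<^bsub>M\<^esub> (\<Oplus>\<^bsub>M\<^esub>b\<in>?S. d b \<odot>\<^bsub>M\<^esub> g b)"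
      using S(2) in_carrier c d by (intro M.M.finsum_addf) blast+
    also have "\<dots> = linear_extension R M g c \<oplus>\<^bsub>M\<^esub> linear_extension R M g d"
      using linear_extension_superset[OF c S] linear_extension_superset[OF d S] by simp
    finally show ?thesis .
  qed
  show "linear_extension R M g (a \<odot>\<^bsub>free_module R B\<^esub> c) = a \<odot>\<^bsub>M\<^esub> linear_extension R M g c"
    if a: "a \<in> carrier R" and c: "c \<in> carrier (free_module R B)" for a c
  proof -
    let ?S = "{b. c b \<noteq> \<zero>}"
    have "linear_extension R M g (a \<odot>\<^bsub>free_module R B\<^esub> c) =
        (\<Oplus>\<^bsub>M\<^esub>b\<in>?S. (a \<odot>\<^bsub>free_module R B\<^esub> c) b \<odot>\<^bsub>M\<^esub> g b)"
      using supp[OF c] a c by (intro linear_extension_superset free_module_smult_closed)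
        (auto simp: free_module_def)
    also have "\<dots> = (\<Oplus>\<^bsub>M\<^esub>b\<in>?S. a \<odot>\<^bsub>M\<^esub> (c b \<odot>\<^bsub>M\<^esub> g b))"
    proof (rule M.M.finsum_cong')
      show "(a \<odot>\<^bsub>free_module R B\<^esub> c) b \<odot>\<^bsub>M\<^esub> g b = a \<odot>\<^bsub>M\<^esub> (c b \<odot>\<^bsub>M\<^esub> g b)"
        if "b \<in> ?S" for b
        using that supp[OF c] a g
        by (subst M.smult_assoc1[symmetric]) (auto simp: free_module_def)
    qed (use a supp[OF c] in_carrier[OF c, of ?S] in \<open>auto simp: Pi_iff\<close>)
    also have "\<dots> = a \<odot>\<^bsub>M\<^esub> linear_extension R M g c"
      unfolding linear_extension_def using a supp[OF c] in_carrier[OF c]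
      by (intro M.finsum_smult_ldistr[symmetric]) auto
    finally show ?thesis .
  qed
qed

lemma linear_extension_basis:
  assumes "b \<in> B"
  shows "linear_extension R M g (basis_elem R b) = g b"
proof -
  have "linear_extension R M g (basis_elem R b) = (\<Oplus>\<^bsub>M\<^esub>i\<in>{b}. basis_elem R b i \<odot>\<^bsub>M\<^esub> g i)"
    using assms by (intro linear_extension_superset basis_elem_closed) (auto simp: basis_elem_def)
  also have "\<dots> = g b"
    using g[OF assms] by (simp add: basis_elem_def)
  finally show ?thesis .
qed

end

text \<open>With \<open>N\<close> the zero submodule this proves that \<open>h\<close> vanishes on
  the span of \<open>A\<close>; with \<open>N\<close> a span of paths it bounds the support of the
  image.\<close>

lemma linear_maps_mem_submodule:
  assumes M: "module R M" and h: "h \<in> linear_maps R (free_module R B) M"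
    and N: "submodule N R M" and basis: "\<And>b. b \<in> A \<Longrightarrow> h (basis_elem R b) \<in> N" and "A \<subseteq> B"
    and c: "c \<in> carrier (free_module R A)"
  shows "h c \<in> N"
  using c
proof (induction rule: free_module_induct)
  case zero
  have "h \<zero>\<^bsub>free_module R A\<^esub> = \<zero>\<^bsub>M\<^esub>"
    using linear_maps_zero[OF module_free_module M h] by (simp add: free_module_def)
  then show ?case using module.submodule_zero_closed[OF M N] by simp
next
  case (add c d)
  have "h (c \<oplus>\<^bsub>free_module R A\<^esub> d) = h c \<oplus>\<^bsub>M\<^esub> h d"
    using linear_maps_add[OF h, of c d] add free_module_carrier_mono[OF \<open>A \<subseteq> B\<close>]
    by (auto simp: free_module_def)
  then show ?case using module.submoduleE(5)[OF M N] add by simp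
next
  case (smult a b)
  have "h (a \<odot>\<^bsub>free_module R A\<^esub> basis_elem R b) = a \<odot>\<^bsub>M\<^esub> h (basis_elem R b)"
    using linear_maps_smult[OF h, of a "basis_elem R b"] smult basis_elem_closed[of b B] \<open>A \<subseteq> B\<close>
    by (auto simp: free_module_def)
  then show ?case using module.submoduleE(4)[OF M N] smult basis by simp
qed

text \<open>The maps may differ outside the span of \<open>A\<close>. This matters for the chain map
  equation, which is tested on allowed paths only.\<close>

lemma linear_maps_eq:
  assumes "module R M" and h: "h \<in> linear_maps R (free_module R B) M"
    and k: "k \<in> linear_maps R (free_module R B) M"
    and basis: "\<And>b. b \<in> A \<Longrightarrow> h (basis_elem R b) = k (basis_elem R b)" and "A \<subseteq> B"
    and c: "c \<in> carrier (free_module R A)"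
  shows "h c = k c"
proof -
  have sub: "c \<in> carrier (free_module R B)" if "c \<in> carrier (free_module R A)" for c
    using free_module_carrier_mono[OF \<open>A \<subseteq> B\<close>] that by blast
  have ops: "\<zero>\<^bsub>free_module R A\<^esub> = \<zero>\<^bsub>free_module R B\<^esub>"
    "(\<oplus>\<^bsub>free_module R A\<^esub>) = (\<oplus>\<^bsub>free_module R B\<^esub>)" "(\<odot>\<^bsub>free_module R A\<^esub>) = (\<odot>\<^bsub>free_module R B\<^esub>)"
    by (simp_all add: free_module_def)
  show ?thesis
    using c
  proof (induction rule: free_module_induct)
    case zero
    show ?case
      using linear_maps_zero[OF module_free_module \<open>module R M\<close> h]
        linear_maps_zero[OF module_free_module \<open>module R M\<close> k] by (simp add: ops)
  next
    case (add c d)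
    then show ?case
      using linear_maps_add[OF h] linear_maps_add[OF k] by (simp add: sub ops)
  next
    case (smult a b)
    then have "basis_elem R b \<in> carrier (free_module R B)"
      using basis_elem_closed[of b B] \<open>A \<subseteq> B\<close> by auto
    with smult show ?case
      using linear_maps_smult[OF h] linear_maps_smult[OF k] basis by (simp add: ops)
  qed
qed

end

section \<open>Alternating sums over the faces of a list\<close>

text \<open>Recursion on the list replaces the sign bookkeeping of the boundary: the faces of \<open>v # p\<close>
  are \<open>p\<close> and the lists \<open>v # q\<close> for the faces \<open>q\<close> of \<open>p\<close>, the latter with opposite sign.\<close>

primrec faces :: "'v list \<Rightarrow> 'v list set" where
  "faces [] = {}"
| "faces (v # p) = insert p ((#) v ` faces p)"

fun alternating_sum :: "('a, 'm) ring_scheme \<Rightarrow> ('v list \<Rightarrow> 'a) \<Rightarrow> 'v list \<Rightarrow> 'a" where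
  "alternating_sum M \<phi> [] = \<zero>\<^bsub>M\<^esub>"
| "alternating_sum M \<phi> (v # p) = \<phi> p \<ominus>\<^bsub>M\<^esub> alternating_sum M (\<lambda>q. \<phi> (v # q)) p"

lemma length_faces: "q \<in> faces p \<Longrightarrow> Suc (length q) = length p"
  by (induction p arbitrary: q) auto

lemma set_faces: "q \<in> faces p \<Longrightarrow> set q \<subseteq> set p"
  by (induction p arbitrary: q) fastforce+

lemma del_nth_faces: "m < length p \<Longrightarrow> del_nth m p \<in> faces p"
proof (induction p arbitrary: m)
  case (Cons v p)
  then show ?case by (cases m) (auto simp: del_nth_def)
qed simp

lemma faces_distinct_adj:
  assumes "asym E" "successively (\<lambda>v w. (v, w) \<in> E) p" "q \<in> faces p"
  shows "distinct_adj q"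
  using assms(2,3)
proof (induction p arbitrary: q rule: induct_list012)
  case (3 v w p)
  have irrefl: "(x, y) \<in> E \<Longrightarrow> x \<noteq> y" for x y
    using \<open>asym E\<close> by (auto dest: asymD)
  have adj: "distinct_adj p'" if "successively (\<lambda>v w. (v, w) \<in> E) p'" for p'
    using that irrefl unfolding distinct_adj_def by (rule successively_mono)
  consider "q = w # p" | "q = v # p" | q' where "q = v # w # q'" "w # q' \<in> faces (w # p)"
    using "3.prems"(2) by auto
  then show ?case
  proof cases
    case 1
    then show ?thesis using adj "3.prems"(1) by simp
  next
    case 2
    have "distinct_adj p" using adj "3.prems"(1) by (cases p) auto
    \<comment> \<open>Only the deletion of \<open>w\<close> creates a new pair of neighbours,
      \<open>v\<close> and \<open>hd p\<close>; in the other cases neighbours come from the path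
      itself or from the induction hypothesis.\<close>
    moreover have "p = [] \<or> v \<noteq> hd p"
      using "3.prems"(1) \<open>asym E\<close> by (cases p) (auto dest: asymD)
    ultimately show ?thesis using 2 by (auto simp: distinct_adj_Cons)
  next
    case 3
    then show ?thesis using "3.IH"(2)[of "w # q'"] "3.prems"(1) irrefl by auto
  qed
qed auto

lemma alternating_sum_cong:
  "(\<And>q. q \<in> faces p \<Longrightarrow> \<phi> q = \<psi> q) \<Longrightarrow> alternating_sum M \<phi> p = alternating_sum M \<psi> p"
proof (induction p arbitrary: \<phi> \<psi>)
  case (Cons v p)
  have "alternating_sum M (\<lambda>q. \<phi> (v # q)) p = alternating_sum M (\<lambda>q. \<psi> (v # q)) p"
    by (rule Cons.IH) (simp add: Cons.prems)
  then show ?case using Cons.prems by simp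
qed simp

lemma alternating_sum_map:
  "alternating_sum M \<phi> (map f p) = alternating_sum M (\<lambda>q. \<phi> (map f q)) p"
  by (induction p arbitrary: \<phi>) auto

lemma (in module) minus_eq_smult:
  "y \<in> carrier M \<Longrightarrow> x \<ominus>\<^bsub>M\<^esub> y = x \<oplus>\<^bsub>M\<^esub> (\<ominus> \<one>) \<odot>\<^bsub>M\<^esub> y"
  using smult_l_minus[of \<one> y] by (simp add: a_minus_def)

text \<open>Closedness and the equation are proved together, since \<open>h\<close> is additive only
  on the carrier. Differences are rewritten as sums with a (-1)-multiple because
  \<open>linear_maps\<close> speaks only of sums and scalar multiples.\<close>

lemma alternating_sum_linear:
  assumes "module R M" "module R N" and h: "h \<in> linear_maps R M N"
    and "\<And>q. q \<in> faces p \<Longrightarrow> \<phi> q \<in> carrier M"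
  shows "alternating_sum M \<phi> p \<in> carrier M \<and>
    h (alternating_sum M \<phi> p) = alternating_sum N (\<lambda>q. h (\<phi> q)) p"
  using assms(4)
proof (induction p arbitrary: \<phi>)
  case Nil
  interpret M: module R M by fact
  show ?case using linear_maps_zero[OF assms(1-3)] by simp
next
  case (Cons v p)
  interpret M: module R M by fact
  interpret N: module R N by fact
  let ?s = "alternating_sum M (\<lambda>q. \<phi> (v # q)) p"
  have IH: "?s \<in> carrier M" "h ?s = alternating_sum N (\<lambda>q. h (\<phi> (v # q))) p"
    using Cons.IH[of "\<lambda>q. \<phi> (v # q)"] Cons.prems by auto
  show ?case
    using Cons.prems[of p] IH(1) linear_maps_closed[OF h] assms(1,2)
    by (simp add: IH(2)[symmetric] module.minus_eq_smult linear_maps_add[OF h] linear_maps_smult[OF h])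
qed

section \<open>Cancellation in alternating sums\<close>

context module
begin

lemma zero_submodule: "submodule {\<zero>\<^bsub>M\<^esub>} R M"
  by (rule submoduleI) auto

text \<open>For \<open>N\<close> the whole carrier this is closedness; for \<open>N\<close> the span
  of the regular paths it controls the support of boundaries.\<close>

lemma alternating_sum_mem:
  assumes N: "submodule N R M"
  shows "(\<And>q. q \<in> faces p \<Longrightarrow> \<phi> q \<in> N) \<Longrightarrow> alternating_sum M \<phi> p \<in> N"
proof (induction p arbitrary: \<phi>)
  case Nil
  show ?case using submodule_zero_closed[OF N] by simp
next
  case (Cons v p)
  have "alternating_sum M (\<lambda>q. \<phi> (v # q)) p \<in> N"
    by (rule Cons.IH) (simp add: Cons.prems)
  then show ?case
    using Cons.prems[of p] submoduleE(3,5)[OF N] by (simp add: a_minus_def)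
qed

lemmas alternating_sum_closed = alternating_sum_mem[OF carrier_is_submodule]

lemma alternating_sum_minus:
  assumes "\<And>q. q \<in> faces p \<Longrightarrow> \<phi> q \<in> carrier M" "\<And>q. q \<in> faces p \<Longrightarrow> \<psi> q \<in> carrier M"
  shows "alternating_sum M (\<lambda>q. \<phi> q \<ominus>\<^bsub>M\<^esub> \<psi> q) p =
    alternating_sum M \<phi> p \<ominus>\<^bsub>M\<^esub> alternating_sum M \<psi> p"
  using assms
proof (induction p arbitrary: \<phi> \<psi>)
  case (Cons v p)
  have "alternating_sum M (\<lambda>q. \<phi> (v # q) \<ominus>\<^bsub>M\<^esub> \<psi> (v # q)) p =
      alternating_sum M (\<lambda>q. \<phi> (v # q)) p \<ominus>\<^bsub>M\<^esub> alternating_sum M (\<lambda>q. \<psi> (v # q)) p"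
    by (rule Cons.IH) (simp_all add: Cons.prems)
  moreover have "alternating_sum M (\<lambda>q. \<phi> (v # q)) p \<in> carrier M"
    "alternating_sum M (\<lambda>q. \<psi> (v # q)) p \<in> carrier M"
    by (intro alternating_sum_closed; simp add: Cons.prems)+
  moreover have "\<phi> p \<in> carrier M" "\<psi> p \<in> carrier M"
    by (simp_all add: Cons.prems)
  ultimately show ?case
    by (simp add: a_minus_def M.minus_add M.minus_minus M.a_ac)
qed (simp add: minus_eq_smult)

text \<open>The identity behind \<partial>\<partial> = 0. For \<open>v # p\<close> the outer
  recursion yields S - (S - D), where S is the sum of \<open>\<phi>\<close> over the faces of
  \<open>p\<close> and D is the double sum over \<open>p\<close> of \<open>\<phi>\<close> with
  \<open>v\<close> prefixed. D vanishes by induction, so no pairs of deletion indices have to be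
  matched.\<close>

lemma alternating_sum_alternating_sum:
  "(\<And>q r. \<lbrakk>q \<in> faces p; r \<in> faces q\<rbrakk> \<Longrightarrow> \<phi> r \<in> carrier M) \<Longrightarrow>
    alternating_sum M (alternating_sum M \<phi>) p = \<zero>\<^bsub>M\<^esub>"
proof (induction p arbitrary: \<phi>)
  case (Cons v p)
  let ?\<psi> = "\<lambda>q. \<phi> (v # q)"
  have \<psi>: "?\<psi> r \<in> carrier M" if "q \<in> faces p" "r \<in> faces q" for q r
    using Cons.prems[of "v # q" "v # r"] that by simp
  have \<phi>: "\<phi> q \<in> carrier M" if "q \<in> faces p" for q
    using Cons.prems[of "v # q" q] that by simp
  have "alternating_sum M (\<lambda>q. alternating_sum M \<phi> (v # q)) p =
      alternating_sum M \<phi> p \<ominus>\<^bsub>M\<^esub> alternating_sum M (alternating_sum M ?\<psi>) p"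
    unfolding alternating_sum.simps
  proof (rule alternating_sum_minus)
    show "alternating_sum M ?\<psi> q \<in> carrier M" if "q \<in> faces p" for q
      by (intro alternating_sum_closed \<psi>[OF that])
  qed (rule \<phi>)
  also have "alternating_sum M (alternating_sum M ?\<psi>) p = \<zero>\<^bsub>M\<^esub>"
    by (intro Cons.IH) (rule \<psi>)
  finally have eq: "alternating_sum M (\<lambda>q. alternating_sum M \<phi> (v # q)) p =
      alternating_sum M \<phi> p \<ominus>\<^bsub>M\<^esub> \<zero>\<^bsub>M\<^esub>" .
  have "alternating_sum M \<phi> p \<in> carrier M"
    by (rule alternating_sum_closed[OF \<phi>])
  then show ?case
    unfolding alternating_sum.simps(2)[of M "alternating_sum M \<phi>"] eq
    by (simp add: a_minus_def M.minus_add M.r_neg2 M.r_neg)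
qed simp

text \<open>If the list starts with \<open>v\<close>, \<open>v\<close>, deleting either copy gives
  the same face with opposite signs, and all other faces keep the repetition. If the repetition lies
  further back, prefixing \<open>v\<close> preserves irregularity and induction applies. The choice
  of the irregular submodule for \<open>N\<close> shows that boundaries preserve irregular chains;
  the zero submodule serves for induced maps.\<close>

lemma alternating_sum_irregular:
  assumes N: "submodule N R M" and "\<not> distinct_adj p"
    and "\<And>q. q \<in> faces p \<Longrightarrow> \<phi> q \<in> carrier M"
    and "\<And>q. \<lbrakk>q \<in> faces p; \<not> distinct_adj q\<rbrakk> \<Longrightarrow> \<phi> q \<in> N"
  shows "alternating_sum M \<phi> p \<in> N"
  using assms(2-4)
proof (induction p arbitrary: \<phi> rule: induct_list012)
  case (3 v w p)
  show ?case
  proof (cases "v = w")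
    case True
    let ?s = "alternating_sum M (\<lambda>q. \<phi> (v # v # q)) p"
    have s: "?s \<in> N"
      using "3.prems"(3) True by (intro alternating_sum_mem[OF N]) auto
    then have "?s \<in> carrier M" using submoduleE(1)[OF N] by blast
    moreover have "\<phi> (v # p) \<in> carrier M" using "3.prems"(2) True by simp
    ultimately have "alternating_sum M \<phi> (v # w # p) = ?s"
      using True by (simp add: a_minus_def M.minus_add M.r_neg2)
    then show ?thesis using s by simp
  next
    case False
    then have irreg: "\<not> distinct_adj (w # p)" using "3.prems"(1) by simp
    have "alternating_sum M (\<lambda>q. \<phi> (v # q)) (w # p) \<in> N"
    proof (rule "3.IH"(2)[OF irreg])
      show "\<phi> (v # q) \<in> carrier M" if "q \<in> faces (w # p)" for q
        by (rule "3.prems"(2)) (use that in auto)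
      show "\<phi> (v # q) \<in> N" if "q \<in> faces (w # p)" "\<not> distinct_adj q" for q
        by (rule "3.prems"(3)) (use that in \<open>auto simp: distinct_adj_Cons\<close>)
    qed
    moreover have "\<phi> (w # p) \<in> N" using "3.prems"(3) irreg by simp
    ultimately show ?thesis
      using submoduleE(3,5)[OF N] unfolding alternating_sum.simps(2)[of M \<phi>]
      by (simp add: a_minus_def)
  qed
qed auto

text \<open>The bridge from the indexed sum in \<open>boundary\<close> to the recursion: index 0
  gives the tail, and the remaining indices, shifted by one, give the sum for the tail with an extra
  factor -1.\<close>

lemma finsum_del_nth:
  assumes "length p = Suc n" "\<And>q. q \<in> faces p \<Longrightarrow> \<phi> q \<in> carrier M"
  shows "(\<Oplus>\<^bsub>M\<^esub>m\<in>{..n}. ((\<ominus> \<one>) [^] m) \<odot>\<^bsub>M\<^esub> \<phi> (del_nth m p)) = alternating_sum M \<phi> p"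
  using assms
proof (induction n arbitrary: p \<phi>)
  case 0
  then obtain v where "p = [v]" by (auto simp: length_Suc_conv)
  then show ?case using 0 by (simp add: del_nth_def a_minus_def)
next
  case (Suc n)
  then obtain v p' where p: "p = v # p'" "length p' = Suc n" by (auto simp: length_Suc_conv)
  let ?t = "\<lambda>m. ((\<ominus> \<one>) [^] m) \<odot>\<^bsub>M\<^esub> \<phi> (v # del_nth m p')"
  have del: "\<phi> (del_nth m p) \<in> carrier M" if "m \<le> Suc n" for m
    by (rule Suc.prems(2)) (use del_nth_faces[of m p] that Suc.prems(1) in simp)
  have t: "?t m \<in> carrier M" if "m \<le> n" for m
    using del[of "Suc m"] that p by (simp add: del_nth_def)
  have IH: "(\<Oplus>\<^bsub>M\<^esub>m\<in>{..n}. ?t m) = alternating_sum M (\<lambda>q. \<phi> (v # q)) p'"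
    by (rule Suc.IH) (use p Suc.prems(2) in auto)
  have "(\<Oplus>\<^bsub>M\<^esub>m\<in>{..Suc n}. ((\<ominus> \<one>) [^] m) \<odot>\<^bsub>M\<^esub> \<phi> (del_nth m p)) =
      (\<Oplus>\<^bsub>M\<^esub>m\<in>{..n}. ((\<ominus> \<one>) [^] Suc m) \<odot>\<^bsub>M\<^esub> \<phi> (del_nth (Suc m) p)) \<oplus>\<^bsub>M\<^esub>
      ((\<ominus> \<one>) [^] (0::nat)) \<odot>\<^bsub>M\<^esub> \<phi> (del_nth 0 p)"
    by (rule M.finsum_Suc2) (use del in auto)
  also have "((\<ominus> \<one>) [^] (0::nat)) \<odot>\<^bsub>M\<^esub> \<phi> (del_nth 0 p) = \<phi> p'"
    using del[of 0] p by (simp add: del_nth_def)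
  also have "(\<Oplus>\<^bsub>M\<^esub>m\<in>{..n}. ((\<ominus> \<one>) [^] Suc m) \<odot>\<^bsub>M\<^esub> \<phi> (del_nth (Suc m) p)) =
      (\<Oplus>\<^bsub>M\<^esub>m\<in>{..n}. (\<ominus> \<one>) \<odot>\<^bsub>M\<^esub> ?t m)"
  proof (rule M.finsum_cong')
    show "(\<lambda>m. (\<ominus> \<one>) \<odot>\<^bsub>M\<^esub> ?t m) \<in> {..n} \<rightarrow> carrier M" using t by auto
    fix m assume "m \<in> {..n}"
    then have "\<phi> (v # del_nth m p') \<in> carrier M"
      using del[of "Suc m"] p by (simp add: del_nth_def)
    then show "((\<ominus> \<one>) [^] Suc m) \<odot>\<^bsub>M\<^esub> \<phi> (del_nth (Suc m) p) = (\<ominus> \<one>) \<odot>\<^bsub>M\<^esub> ?t m"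
      using p by (simp add: del_nth_def smult_assoc1[symmetric] m_comm)
  qed simp
  also have "\<dots> = (\<ominus> \<one>) \<odot>\<^bsub>M\<^esub> (\<Oplus>\<^bsub>M\<^esub>m\<in>{..n}. ?t m)"
    by (rule finsum_smult_ldistr[symmetric]) (use t in auto)
  also have "\<dots> \<oplus>\<^bsub>M\<^esub> \<phi> p' = alternating_sum M \<phi> p"
  proof -
    have "(\<Oplus>\<^bsub>M\<^esub>m\<in>{..n}. ?t m) \<in> carrier M" using t by (intro M.finsum_closed) auto
    then show ?thesis
      using IH p Suc.prems(2)[of p'] smult_l_minus[of \<one>]
      by (simp add: a_minus_def M.a_comm)
  qed
  finally show ?case .
qed

end

section \<open>Boundaries and induced maps of chains of paths\<close>

definition irregular_paths :: "'v set \<Rightarrow> int \<Rightarrow> 'v list set" where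
  "irregular_paths V n = {p \<in> elem_paths V n. \<not> distinct_adj p}"

definition regular_paths :: "'v set \<Rightarrow> int \<Rightarrow> 'v list set" where
  "regular_paths V n = {p \<in> elem_paths V n. distinct_adj p}"

text \<open>The bound \<open>n \<ge> 1\<close> excludes one-vertex lists: their face
  \<open>[]\<close> is not an elementary path.\<close>

lemma faces_elem_paths:
  "\<lbrakk>p \<in> elem_paths V n; q \<in> faces p; n \<ge> 1\<rbrakk> \<Longrightarrow> q \<in> elem_paths V (n - 1)"
  using length_faces[of q p] set_faces[of q p] by (auto simp: elem_paths_def)

lemma map_elem_paths:
  "\<lbrakk>p \<in> elem_paths V n; f ` V \<subseteq> W\<rbrakk> \<Longrightarrow> map f p \<in> elem_paths W n"
  by (auto simp: elem_paths_def)

lemma allowed_regular: "asym (parcs G) \<Longrightarrow> allowed_paths G n \<subseteq> regular_paths (pverts G) n"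
  unfolding allowed_paths_def regular_paths_def distinct_adj_def
  by (auto dest: asymD elim!: successively_mono)

text \<open>A digraph map may collapse an arrow to a vertex; regularity of the image path excludes
  exactly this alternative.\<close>

lemma map_allowed_paths:
  assumes "digraph_map G H f" "p \<in> allowed_paths G n" "distinct_adj (map f p)"
  shows "map f p \<in> allowed_paths H n"
proof -
  have "successively (\<lambda>v w. (v, w) \<in> parcs H) (map f p)"
    if "successively (\<lambda>v w. (v, w) \<in> parcs G) p" "distinct_adj (map f p)"
    using that
  proof (induction p rule: induct_list012)
    case (3 v w p)
    then have "f v = f w \<or> (f v, f w) \<in> parcs H"
      using assms(1) by (auto simp: digraph_map_def)
    with 3 show ?case by auto
  qed auto
  with assms show ?thesis
    using map_elem_paths[of p "pverts G" n f "pverts H"]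
    by (auto simp: allowed_paths_def digraph_map_def)
qed

context cring
begin

section \<open>Path modules and their irregular and allowed submodules\<close>

lemma module_path_module: "module R (path_module R V n)"
  unfolding path_module_def by (rule module_free_module)

lemma path_module_zero_closed: "\<zero>\<^bsub>path_module R V n\<^esub> \<in> carrier (path_module R V n)"
  using module.submodule_zero_closed[OF module_path_module module.carrier_is_submodule[OF module_path_module]] .

lemma basis_elem_path_module:
  "p \<in> elem_paths V n \<Longrightarrow> basis_elem R p \<in> carrier (path_module R V n)"
  by (simp add: path_module_def basis_elem_closed)

lemma irregular_submodule_eq:
  "irregular_submodule R V n = carrier (free_module R (irregular_paths V n))"
  unfolding irregular_submodule_def path_module_def irregular_paths_def
  by (rule generated_submodule_basis) auto

lemma allowed_submodule_eq:
  "allowed_submodule R G n = carrier (free_module R (allowed_paths G n))"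
  unfolding allowed_submodule_def path_module_def
  by (rule generated_submodule_basis) (auto simp: allowed_paths_def)

lemma submodule_path_module:
  "A \<subseteq> elem_paths V n \<Longrightarrow> submodule (carrier (free_module R A)) R (path_module R V n)"
  unfolding path_module_def by (rule submodule_free_module)

lemma submodule_irregular: "submodule (irregular_submodule R V n) R (path_module R V n)"
  unfolding irregular_submodule_eq
  by (rule submodule_path_module) (auto simp: irregular_paths_def)

lemma submodule_allowed: "submodule (allowed_submodule R G n) R (path_module R (pverts G) n)"
  unfolding allowed_submodule_eq
  by (rule submodule_path_module) (auto simp: allowed_paths_def)

lemma path_maps_mem_submodule:
  assumes "module R M" "h \<in> linear_maps R (path_module R V n) M" "submodule N R M"
    and "A \<subseteq> elem_paths V n" "c \<in> carrier (free_module R A)"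
    and "\<And>p. p \<in> A \<Longrightarrow> h (basis_elem R p) \<in> N"
  shows "h c \<in> N"
  using linear_maps_mem_submodule[of M h "elem_paths V n" N A c] assms
  by (simp add: path_module_def)

lemma path_maps_eq:
  assumes "module R M" "h \<in> linear_maps R (path_module R V n) M"
    and "k \<in> linear_maps R (path_module R V n) M"
    and "A \<subseteq> elem_paths V n" "c \<in> carrier (free_module R A)"
    and "\<And>p. p \<in> A \<Longrightarrow> h (basis_elem R p) = k (basis_elem R p)"
  shows "h c = k c"
  using linear_maps_eq[of M h "elem_paths V n" k A c] assms
  by (simp add: path_module_def)

section \<open>The boundary on elementary paths\<close>

lemma boundary_term_eq:
  assumes "n \<ge> 1" "p \<in> elem_paths V n"
  shows "(\<Oplus>\<^bsub>path_module R V (n - 1)\<^esub>m\<in>{0..nat n}.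
      ((\<ominus> \<one>) [^] m) \<odot>\<^bsub>path_module R V (n - 1)\<^esub> basis_elem R (del_nth m p)) =
    alternating_sum (path_module R V (n - 1)) (basis_elem R) p"
  unfolding atLeast0AtMost
proof (rule module.finsum_del_nth[OF module_path_module])
  show "length p = Suc (nat n)" using assms by (auto simp: elem_paths_def)
  show "basis_elem R q \<in> carrier (path_module R V (n - 1))" if "q \<in> faces p" for q
    using faces_elem_paths[OF assms(2) that assms(1)] by (rule basis_elem_path_module)
qed

lemma alternating_sum_basis_closed:
  assumes "n \<ge> 1" "p \<in> elem_paths V n"
  shows "alternating_sum (path_module R V (n - 1)) (basis_elem R) p \<in> carrier (path_module R V (n - 1))"
  by (intro module.alternating_sum_closed[OF module_path_module] basis_elem_path_module
      faces_elem_paths[OF assms(2) _ assms(1)])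

text \<open>The alternating sum describes the boundary only from degree 1 on. In degree 0 the
  differential is zero by convention and does not send a vertex to the empty list.\<close>

lemma
  shows boundary_linear:
      "boundary R V n \<in> linear_maps R (path_module R V n) (path_module R V (n - 1))"
    and boundary_basis: "\<lbrakk>n \<ge> 1; p \<in> elem_paths V n\<rbrakk> \<Longrightarrow> boundary R V n (basis_elem R p) =
      alternating_sum (path_module R V (n - 1)) (basis_elem R) p"
    and boundary_basis_nonpos: "\<lbrakk>n < 1; p \<in> elem_paths V n\<rbrakk> \<Longrightarrow>
      boundary R V n (basis_elem R p) = \<zero>\<^bsub>path_module R V (n - 1)\<^esub>"
proof -
  interpret N: module R "path_module R V (n - 1)" by (rule module_path_module)
  let ?g = "\<lambda>p. if n \<ge> 1
          then \<Oplus>\<^bsub>path_module R V (n - 1)\<^esub>m\<in>{0..nat n}.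
                 ((\<ominus> \<one>) [^] m) \<odot>\<^bsub>path_module R V (n - 1)\<^esub> basis_elem R (del_nth m p)
          else \<zero>\<^bsub>path_module R V (n - 1)\<^esub>"
  have g: "?g p \<in> carrier (path_module R V (n - 1))" if "p \<in> elem_paths V n" for p
    using that N.M.zero_closed by (simp add: boundary_term_eq alternating_sum_basis_closed)
  show "boundary R V n \<in> linear_maps R (path_module R V n) (path_module R V (n - 1))"
    unfolding boundary_def path_module_def[of R V n]
    by (rule linear_extension_linear[OF module_path_module g])
  have basis: "boundary R V n (basis_elem R p) = ?g p" if "p \<in> elem_paths V n"
    unfolding boundary_def using g that by (rule linear_extension_basis[OF module_path_module])
  show "boundary R V n (basis_elem R p) =
      alternating_sum (path_module R V (n - 1)) (basis_elem R) p"
    if "n \<ge> 1" "p \<in> elem_paths V n"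
    using basis that by (simp add: boundary_term_eq)
  show "boundary R V n (basis_elem R p) = \<zero>\<^bsub>path_module R V (n - 1)\<^esub>"
    if "n < 1" "p \<in> elem_paths V n"
    using basis that by simp
qed

lemma boundary_closed:
  "c \<in> carrier (path_module R V n) \<Longrightarrow> boundary R V n c \<in> carrier (path_module R V (n - 1))"
  by (rule linear_maps_closed[OF boundary_linear])

lemma boundary_nonpos:
  assumes "n < 1" "c \<in> carrier (path_module R V n)"
  shows "boundary R V n c = \<zero>\<^bsub>path_module R V (n - 1)\<^esub>"
proof -
  have "boundary R V n c \<in> {\<zero>\<^bsub>path_module R V (n - 1)\<^esub>}"
    by (rule path_maps_mem_submodule[OF module_path_module boundary_linear
          module.zero_submodule[OF module_path_module] subset_refl])
      (use assms in \<open>simp_all add: boundary_basis_nonpos path_module_def[of R V n]\<close>)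
  then show ?thesis by simp
qed

lemma boundary_boundary:
  assumes "c \<in> carrier (path_module R V n)"
  shows "boundary R V (n - 1) (boundary R V n c) = \<zero>\<^bsub>path_module R V (n - 2)\<^esub>"
\<comment> \<open>For \<open>n < 2\<close> the outer boundary acts in a degree below 1 and is zero;
  otherwise both boundaries are alternating sums.\<close>
proof (cases "n < 2")
  case True
  then show ?thesis using boundary_nonpos[OF _ boundary_closed[OF assms]] by simp
next
  case False
  then have n: "n \<ge> 1" "n - 1 \<ge> 1" by auto
  have lin: "(\<lambda>c. boundary R V (n - 1) (boundary R V n c)) \<in>
      linear_maps R (path_module R V n) (path_module R V (n - 2))"
    using linear_maps_comp[OF boundary_linear[of V n] boundary_linear[of V "n - 1"]] by simp
  have "boundary R V (n - 1) (boundary R V n c) \<in> {\<zero>\<^bsub>path_module R V (n - 2)\<^esub>}"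
  proof (rule path_maps_mem_submodule[OF module_path_module lin
        module.zero_submodule[OF module_path_module] subset_refl])
    show "c \<in> carrier (free_module R (elem_paths V n))"
      using assms by (simp add: path_module_def)
    fix p assume p: "p \<in> elem_paths V n"
    have "boundary R V (n - 1) (boundary R V n (basis_elem R p)) =
        boundary R V (n - 1) (alternating_sum (path_module R V (n - 1)) (basis_elem R) p)"
      by (simp add: boundary_basis[OF n(1) p])
    also have "\<dots> = alternating_sum (path_module R V (n - 2))
        (\<lambda>q. boundary R V (n - 1) (basis_elem R q)) p"
      using alternating_sum_linear[OF module_path_module module_path_module
          boundary_linear[of V "n - 1"], of p "basis_elem R"]
        by (simp add: basis_elem_path_module[OF faces_elem_paths[OF p _ n(1)]])
    also have "\<dots> = alternating_sum (path_module R V (n - 2))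
        (alternating_sum (path_module R V (n - 2)) (basis_elem R)) p"
      using boundary_basis[OF n(2) faces_elem_paths[OF p _ n(1)]]
      by (intro alternating_sum_cong) simp
    also have "\<dots> = \<zero>\<^bsub>path_module R V (n - 2)\<^esub>"
    proof (rule module.alternating_sum_alternating_sum[OF module_path_module])
      fix q r assume "q \<in> faces p" "r \<in> faces q"
      then have "r \<in> elem_paths V (n - 1 - 1)"
        by (intro faces_elem_paths[OF faces_elem_paths[OF p]] n)
      then show "basis_elem R r \<in> carrier (path_module R V (n - 2))"
        by (simp add: basis_elem_path_module)
    qed
    finally show "boundary R V (n - 1) (boundary R V n (basis_elem R p)) \<in>
        {\<zero>\<^bsub>path_module R V (n - 2)\<^esub>}" by simp
  qed
  then show ?thesis by simp
qed

text \<open>The regular faces of an irregular path cancel each other. This makes the differential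
  well defined on classes.\<close>

lemma boundary_irregular:
  assumes "c \<in> irregular_submodule R V n"
  shows "boundary R V n c \<in> irregular_submodule R V (n - 1)"
proof (rule path_maps_mem_submodule[OF module_path_module boundary_linear submodule_irregular])
  show "irregular_paths V n \<subseteq> elem_paths V n" by (auto simp: irregular_paths_def)
  show "c \<in> carrier (free_module R (irregular_paths V n))"
    using assms by (simp add: irregular_submodule_eq)
  fix p assume p: "p \<in> irregular_paths V n"
  then have irreg: "\<not> distinct_adj p" and p': "p \<in> elem_paths V n"
    by (auto simp: irregular_paths_def)
  show "boundary R V n (basis_elem R p) \<in> irregular_submodule R V (n - 1)"
  proof (cases "n \<ge> 1")
    case True
    have "alternating_sum (path_module R V (n - 1)) (basis_elem R) p \<in> irregular_submodule R V (n - 1)"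
    proof (rule module.alternating_sum_irregular[OF module_path_module submodule_irregular irreg])
      fix q assume "q \<in> faces p"
      then have q: "q \<in> elem_paths V (n - 1)"
        by (intro faces_elem_paths[OF p'] True)
      then show "basis_elem R q \<in> carrier (path_module R V (n - 1))"
        by (rule basis_elem_path_module)
      show "basis_elem R q \<in> irregular_submodule R V (n - 1)" if "\<not> distinct_adj q"
        using q that by (simp add: irregular_submodule_eq irregular_paths_def basis_elem_closed)
    qed
    then show ?thesis by (simp add: boundary_basis[OF True p'])
  next
    case False
    then show ?thesis
      using boundary_basis_nonpos[OF _ p']
        module.submodule_zero_closed[OF module_path_module submodule_irregular] by simp
  qed
qed

text \<open>Regular is weaker than allowed, so allowedness of the boundary remains a genuine
  condition on \<open>c\<close>. Regularity is what allows the boundary to be recovered from its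
  class by \<open>regular_class_inj\<close>.\<close>

lemma boundary_allowed_regular:
  assumes "asym (parcs G)" "c \<in> allowed_submodule R G n"
  shows "boundary R (pverts G) n c \<in> carrier (free_module R (regular_paths (pverts G) (n - 1)))"
proof (rule path_maps_mem_submodule[OF module_path_module boundary_linear])
  show reg: "submodule (carrier (free_module R (regular_paths (pverts G) (n - 1)))) R
      (path_module R (pverts G) (n - 1))"
    by (rule submodule_path_module) (auto simp: regular_paths_def)
  show "allowed_paths G n \<subseteq> elem_paths (pverts G) n"
    by (auto simp: allowed_paths_def)
  show "c \<in> carrier (free_module R (allowed_paths G n))"
    using assms(2) by (simp add: allowed_submodule_eq)
  fix p assume p: "p \<in> allowed_paths G n"
  then have p': "p \<in> elem_paths (pverts G) n" and succ: "successively (\<lambda>v w. (v, w) \<in> parcs G) p"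
    by (auto simp: allowed_paths_def)
  show "boundary R (pverts G) n (basis_elem R p) \<in>
      carrier (free_module R (regular_paths (pverts G) (n - 1)))"
  proof (cases "n \<ge> 1")
    case True
    have "q \<in> regular_paths (pverts G) (n - 1)" if "q \<in> faces p" for q
      using faces_elem_paths[OF p' that True] faces_distinct_adj[OF assms(1) succ that]
      by (simp add: regular_paths_def)
    then have "alternating_sum (path_module R (pverts G) (n - 1)) (basis_elem R) p \<in>
        carrier (free_module R (regular_paths (pverts G) (n - 1)))"
      by (intro module.alternating_sum_mem[OF module_path_module reg] basis_elem_closed)
    then show ?thesis by (simp add: boundary_basis[OF True p'])
  next
    case False
    then show ?thesis
      using boundary_basis_nonpos[OF _ p'] module.submodule_zero_closed[OF module_path_module reg]
      by simp
  qed
qed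

section \<open>Induced maps on chains of paths\<close>

lemma
  assumes f: "f ` pverts G \<subseteq> pverts H"
  shows Pi_map_linear: "Pi_map R G H f n \<in>
      linear_maps R (path_module R (pverts G) n) (path_module R (pverts H) n)"
    and Pi_map_basis: "p \<in> elem_paths (pverts G) n \<Longrightarrow> Pi_map R G H f n (basis_elem R p) =
      (if distinct_adj (map f p) then basis_elem R (map f p)
       else \<zero>\<^bsub>path_module R (pverts H) n\<^esub>)"
proof -
  interpret N: module R "path_module R (pverts H) n" by (rule module_path_module)
  have g: "(if distinct_adj (map f p) then basis_elem R (map f p)
      else \<zero>\<^bsub>path_module R (pverts H) n\<^esub>) \<in> carrier (path_module R (pverts H) n)"
    if "p \<in> elem_paths (pverts G) n" for p
    using map_elem_paths[OF that f] by (simp add: basis_elem_path_module)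
  show "Pi_map R G H f n \<in> linear_maps R (path_module R (pverts G) n) (path_module R (pverts H) n)"
    unfolding Pi_map_def path_module_def[of R "pverts G"]
    by (rule linear_extension_linear[OF module_path_module g])
  show "Pi_map R G H f n (basis_elem R p) = (if distinct_adj (map f p) then basis_elem R (map f p)
       else \<zero>\<^bsub>path_module R (pverts H) n\<^esub>)" if "p \<in> elem_paths (pverts G) n"
    unfolding Pi_map_def using g that by (rule linear_extension_basis[OF module_path_module])
qed

lemma Pi_map_irregular:
  assumes f: "f ` pverts G \<subseteq> pverts H" and "c \<in> irregular_submodule R (pverts G) n"
  shows "Pi_map R G H f n c \<in> irregular_submodule R (pverts H) n"
proof (rule path_maps_mem_submodule[OF module_path_module Pi_map_linear[OF f] submodule_irregular])
  show "irregular_paths (pverts G) n \<subseteq> elem_paths (pverts G) n" by (auto simp: irregular_paths_def)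
  show "c \<in> carrier (free_module R (irregular_paths (pverts G) n))"
    using assms by (simp add: irregular_submodule_eq)
  show "Pi_map R G H f n (basis_elem R p) \<in> irregular_submodule R (pverts H) n"
    if "p \<in> irregular_paths (pverts G) n" for p
    using that Pi_map_basis[OF f, of p n] distinct_adj_mapD[of f p]
      module.submodule_zero_closed[OF module_path_module submodule_irregular]
    by (auto simp: irregular_paths_def)
qed

lemma Pi_map_allowed:
  assumes map: "digraph_map G H f" and "c \<in> allowed_submodule R G n"
  shows "Pi_map R G H f n c \<in> allowed_submodule R H n"
proof -
  have f: "f ` pverts G \<subseteq> pverts H" using map by (simp add: digraph_map_def)
  show ?thesis
  proof (rule path_maps_mem_submodule[OF module_path_module Pi_map_linear[OF f] submodule_allowed])
    show "allowed_paths G n \<subseteq> elem_paths (pverts G) n" by (auto simp: allowed_paths_def)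
    show "c \<in> carrier (free_module R (allowed_paths G n))"
      using assms by (simp add: allowed_submodule_eq)
    fix p assume p: "p \<in> allowed_paths G n"
    then show "Pi_map R G H f n (basis_elem R p) \<in> allowed_submodule R H n"
      using Pi_map_basis[OF f, of p n] map_allowed_paths[OF map p]
        module.submodule_zero_closed[OF module_path_module submodule_allowed[of H n]]
      by (auto simp: allowed_submodule_eq basis_elem_closed allowed_paths_def[of G])
  qed
qed

text \<open>On an allowed path both sides equal the alternating sum over the faces of the image path
  in which irregular faces count as zero. Asymmetry of \<open>H\<close> guarantees that the boundary
  of a regular image has no irregular faces to be discarded.\<close>

lemma boundary_Pi_map:
  assumes map: "digraph_map G H f" and asym: "asym (parcs H)" and c: "c \<in> allowed_submodule R G n"
  shows "boundary R (pverts H) n (Pi_map R G H f n c) =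
    Pi_map R G H f (n - 1) (boundary R (pverts G) n c)"
proof -
  have f: "f ` pverts G \<subseteq> pverts H" using map by (simp add: digraph_map_def)
  let ?L = "path_module R (pverts H) (n - 1)"
  \<comment> \<open>The value of the induced map on a path, expressed through the image
    \<open>q\<close> of that path alone; thus the sum over the faces of \<open>p\<close> becomes a
    sum over the faces of \<open>map f p\<close>.\<close>
  let ?\<phi> = "\<lambda>q. if distinct_adj q then basis_elem R q else \<zero>\<^bsub>?L\<^esub>"
  show ?thesis
  proof (rule path_maps_eq[OF module_path_module linear_maps_comp[OF Pi_map_linear[OF f] boundary_linear]
        linear_maps_comp[OF boundary_linear Pi_map_linear[OF f]]])
    show "allowed_paths G n \<subseteq> elem_paths (pverts G) n" by (auto simp: allowed_paths_def)
    show "c \<in> carrier (free_module R (allowed_paths G n))"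
      using c by (simp add: allowed_submodule_eq)
    fix p assume p: "p \<in> allowed_paths G n"
    then have p': "p \<in> elem_paths (pverts G) n" by (auto simp: allowed_paths_def)
    then have fp: "map f p \<in> elem_paths (pverts H) n" using f by (rule map_elem_paths)
    show "boundary R (pverts H) n (Pi_map R G H f n (basis_elem R p)) =
        Pi_map R G H f (n - 1) (boundary R (pverts G) n (basis_elem R p))"
    proof (cases "n \<ge> 1")
      case False
      then show ?thesis
        using boundary_nonpos[OF _ linear_maps_closed[OF Pi_map_linear[OF f]
              basis_elem_path_module[OF p']]] boundary_basis_nonpos[OF _ p']
          linear_maps_zero[OF module_path_module module_path_module Pi_map_linear[OF f]]
        by simp
    next
      case True
      have "Pi_map R G H f (n - 1) (boundary R (pverts G) n (basis_elem R p)) =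
          alternating_sum ?L (\<lambda>q. Pi_map R G H f (n - 1) (basis_elem R q)) p"
        using alternating_sum_linear[OF module_path_module module_path_module
            Pi_map_linear[OF f, of "n - 1"], of p "basis_elem R"]
          basis_elem_path_module[OF faces_elem_paths[OF p' _ True]]
        by (simp add: boundary_basis[OF True p'])
      also have "\<dots> = alternating_sum ?L (\<lambda>q. ?\<phi> (map f q)) p"
        by (intro alternating_sum_cong) (simp add: Pi_map_basis[OF f faces_elem_paths[OF p' _ True]])
      also have "\<dots> = alternating_sum ?L ?\<phi> (map f p)"
        by (rule alternating_sum_map[symmetric])
      also have "\<dots> = boundary R (pverts H) n (Pi_map R G H f n (basis_elem R p))"
      proof (cases "distinct_adj (map f p)")
        \<comment> \<open>A regular image is allowed in \<open>H\<close>, so all its faces are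
          regular and \<open>?\<phi>\<close> suppresses none of them.\<close>
        case reg: True
        then have "successively (\<lambda>v w. (v, w) \<in> parcs H) (map f p)"
          using map_allowed_paths[OF map p] by (simp add: allowed_paths_def)
        then have "alternating_sum ?L ?\<phi> (map f p) = alternating_sum ?L (basis_elem R) (map f p)"
          using faces_distinct_adj[OF asym] by (intro alternating_sum_cong) simp
        then show ?thesis
          using reg boundary_basis[OF True fp] Pi_map_basis[OF f p'] by simp
      next
        case irreg: False
        \<comment> \<open>The induced map kills the path itself, so the sum has to vanish. Since
          \<open>?\<phi>\<close> is zero on irregular lists, the cancellation lemma applies with the
          zero submodule.\<close>
        have "alternating_sum ?L ?\<phi> (map f p) \<in> {\<zero>\<^bsub>?L\<^esub>}"
        proof (rule module.alternating_sum_irregular[OF module_path_module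
              module.zero_submodule[OF module_path_module] irreg])
          show "?\<phi> q \<in> carrier ?L" if "q \<in> faces (map f p)" for q
            using basis_elem_path_module[OF faces_elem_paths[OF fp that True]]
            by (simp add: path_module_zero_closed)
        qed simp
        then show ?thesis
          using irreg Pi_map_basis[OF f p']
            linear_maps_zero[OF module_path_module module_path_module
              boundary_linear[of "pverts H" n]] by simp
      qed
      finally show ?thesis by simp
    qed
  qed
qed

text \<open>Even for \<open>id\<close> the induced map kills irregular paths, so it is the identity
  only on chains of regular paths; allowed chains are of this kind.\<close>

lemma Pi_map_id:
  assumes "asym (parcs G)" "c \<in> allowed_submodule R G n"
  shows "Pi_map R G G id n c = c"
proof (rule path_maps_eq[OF module_path_module Pi_map_linear])
  show "(\<lambda>c. c) \<in> linear_maps R (path_module R (pverts G) n) (path_module R (pverts G) n)"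
    by (simp add: linear_maps_def)
  show "allowed_paths G n \<subseteq> elem_paths (pverts G) n" by (auto simp: allowed_paths_def)
  show "c \<in> carrier (free_module R (allowed_paths G n))"
    using assms by (simp add: allowed_submodule_eq)
  show "Pi_map R G G id n (basis_elem R p) = basis_elem R p" if "p \<in> allowed_paths G n" for p
  proof -
    have "p \<in> regular_paths (pverts G) n"
      using allowed_regular[OF assms(1)] that by blast
    then show ?thesis
      using Pi_map_basis[of id G G p n] by (simp add: regular_paths_def)
  qed
qed simp

text \<open>If \<open>map f p\<close> is irregular, so is its image under \<open>g\<close>; hence a
  path killed at the first stage is killed by the composite as well.\<close>

lemma Pi_map_comp:
  assumes f: "f ` pverts G \<subseteq> pverts H" and g: "g ` pverts H \<subseteq> pverts K"
    and c: "c \<in> carrier (path_module R (pverts G) n)"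
  shows "Pi_map R G K (g \<circ> f) n c = Pi_map R H K g n (Pi_map R G H f n c)"
proof -
  have gf: "(g \<circ> f) ` pverts G \<subseteq> pverts K" using f g by auto
  show ?thesis
  proof (rule path_maps_eq[OF module_path_module Pi_map_linear[OF gf]
        linear_maps_comp[OF Pi_map_linear[OF f] Pi_map_linear[OF g]] subset_refl])
  show "c \<in> carrier (free_module R (elem_paths (pverts G) n))"
    using c by (simp add: path_module_def)
  fix p assume p: "p \<in> elem_paths (pverts G) n"
  show "Pi_map R G K (g \<circ> f) n (basis_elem R p) = Pi_map R H K g n (Pi_map R G H f n (basis_elem R p))"
    using Pi_map_basis[OF gf p] Pi_map_basis[OF f p] Pi_map_basis[OF g map_elem_paths[OF p f]]
      distinct_adj_mapD[of g "map f p"]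
      linear_maps_zero[OF module_path_module module_path_module Pi_map_linear[OF g]]
    by auto
qed
qed

end

section \<open>Quotient modules\<close>

lemma (in module) abelian_subgroup_submodule: "submodule N R M \<Longrightarrow> abelian_subgroup N M"
  by (intro abelian_subgroupI3 additive_subgroupI M.abelian_group_axioms submodule.axioms(1))

text \<open>Members of one coset of \<open>N\<close> have images differing by an element of
  \<open>N'\<close>, so the union defining \<open>quotient_map\<close> has equal members.\<close>

lemma quotient_map_coset:
  assumes "module R M" "module R M'" and N: "submodule N R M" and N': "submodule N' R M'"
    and h: "h \<in> linear_maps R M M'" and "\<And>y. y \<in> N \<Longrightarrow> h y \<in> N'" and x: "x \<in> carrier M"
  shows "quotient_map M' N' h (N +>\<^bsub>M\<^esub> x) = N' +>\<^bsub>M'\<^esub> h x"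
proof -
  interpret M: module R M by fact
  interpret M': module R M' by fact
  have "N' +>\<^bsub>M'\<^esub> h y = N' +>\<^bsub>M'\<^esub> h x" if y: "y \<in> N +>\<^bsub>M\<^esub> x" for y
  proof -
    obtain n where n: "n \<in> N" "y = n \<oplus>\<^bsub>M\<^esub> x"
      using y by (auto simp: a_r_coset_def')
    then have "h y = h n \<oplus>\<^bsub>M'\<^esub> h x"
      using linear_maps_add[OF h _ x] M.submoduleE(1)[OF N] by auto
    then have "h y \<in> N' +>\<^bsub>M'\<^esub> h x"
      using M'.a_rcosI M'.submoduleE(1)[OF N'] assms(6)[OF n(1)] linear_maps_closed[OF h x] by simp
    then show ?thesis
      using M'.a_repr_independence linear_maps_closed[OF h x] submodule.axioms(1)[OF N'] by metis
  qed
  \<comment> \<open>The coset is nonempty, so the union of equal cosets is that coset rather than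
    the empty set.\<close>
  moreover have "x \<in> N +>\<^bsub>M\<^esub> x"
    by (rule abelian_subgroup.a_rcos_self[OF M.abelian_subgroup_submodule[OF N] x])
  ultimately show ?thesis
    unfolding quotient_map_def by blast
qed

lemma smult_linear:
  fixes M :: "('r, 'a) module"
  assumes "module R M" "a \<in> carrier R"
  shows "(\<lambda>x. a \<odot>\<^bsub>M\<^esub> x) \<in> linear_maps R M M"
proof -
  interpret module R M by fact
  show ?thesis
    using assms(2) by (intro linear_mapsI) (simp_all add: smult_r_distr smult_assoc1[symmetric] m_comm)
qed

lemma coset_linear:
  fixes M :: "('r, 'a) module"
  assumes "module R M" and N: "submodule N R M"
  shows "(\<lambda>x. N +>\<^bsub>M\<^esub> x) \<in> linear_maps R M (quotient_module M N)"
proof -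
  interpret M: module R M by fact
  show ?thesis
  proof (rule linear_mapsI)
    show "N +>\<^bsub>M\<^esub> x \<in> carrier (quotient_module M N)" if "x \<in> carrier M" for x
      using M.a_rcosetsI[OF M.submoduleE(1)[OF N] that] by (simp add: quotient_module_def)
    show "N +>\<^bsub>M\<^esub> (x \<oplus>\<^bsub>M\<^esub> y) = (N +>\<^bsub>M\<^esub> x) \<oplus>\<^bsub>quotient_module M N\<^esub> (N +>\<^bsub>M\<^esub> y)"
      if "x \<in> carrier M" "y \<in> carrier M" for x y
      using abelian_subgroup.a_rcos_sum[OF M.abelian_subgroup_submodule[OF N] that]
      by (simp add: quotient_module_def)
    show "N +>\<^bsub>M\<^esub> (a \<odot>\<^bsub>M\<^esub> x) = a \<odot>\<^bsub>quotient_module M N\<^esub> (N +>\<^bsub>M\<^esub> x)"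
      if a: "a \<in> carrier R" and x: "x \<in> carrier M" for a x
      \<comment> \<open>Scalar multiplication in \<open>quotient_module\<close> is the same union as
        \<open>quotient_map\<close> for the linear map x \<mapsto> a x, so it is computed on
        representatives.\<close>
      using quotient_map_coset[OF assms(1,1) N N smult_linear[OF assms(1) a] M.submoduleE(4)[OF N a] x]
      by (simp add: quotient_module_def quotient_map_def)
  qed
qed


section \<open>The comparison of the two complexes\<close>

lemma linear_maps_restrict:
  assumes "h \<in> linear_maps R M N" "A \<subseteq> carrier M" "\<And>x. x \<in> A \<Longrightarrow> h x \<in> B"
  shows "h \<in> linear_maps R (M\<lparr>carrier := A\<rparr>) (N\<lparr>carrier := B\<rparr>)"
  using assms by (auto simp: linear_maps_def subset_iff)

lemma linear_maps_transport:
  assumes "module R M" and h: "h \<in> linear_maps R M N"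
    and \<theta>: "\<theta> \<in> linear_maps R M M'" and surj: "\<theta> ` carrier M = carrier M'"
    and \<theta>': "\<theta>' \<in> linear_maps R N N'"
    and k: "\<And>x. x \<in> carrier M \<Longrightarrow> k (\<theta> x) = \<theta>' (h x)"
  shows "k \<in> linear_maps R M' N'"
proof -
  interpret M: module R M by fact
  note lin = linear_maps_closed[OF h] linear_maps_closed[OF \<theta>']
    linear_maps_add[OF h] linear_maps_add[OF \<theta>'] linear_maps_smult[OF h] linear_maps_smult[OF \<theta>']
    linear_maps_add[OF \<theta>, symmetric] linear_maps_smult[OF \<theta>, symmetric]
  have lift: "P y" if "y \<in> carrier M'" "\<And>x. x \<in> carrier M \<Longrightarrow> P (\<theta> x)" for P y
    using that surj by (metis imageE)
  show ?thesis
  proof (rule linear_mapsI)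
    fix x assume x: "x \<in> carrier M'"
    show "k x \<in> carrier N'"
      by (rule lift[OF x]) (simp add: k lin)
    show "k (x \<oplus>\<^bsub>M'\<^esub> y) = k x \<oplus>\<^bsub>N'\<^esub> k y" if y: "y \<in> carrier M'" for y
      by (rule lift[OF x], rule lift[OF y]) (simp add: k lin)
    show "k (a \<odot>\<^bsub>M'\<^esub> x) = a \<odot>\<^bsub>N'\<^esub> k x" if "a \<in> carrier R" for a
      by (rule lift[OF x]) (simp add: k lin that)
  qed
qed

text \<open>Since \<open>\<theta>\<close> is onto, every chain of \<open>E\<close> has the form
  \<open>\<theta> G n x\<close>, and compatibility moves each law to one of \<open>F\<close>.
  Applied to the class map, this yields the module axioms and functor laws of Omega without
  arithmetic of cosets.\<close>

lemma digraph_functor_transport: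
  assumes F: "digraph_functor R F F'"
    and \<theta>: "\<And>G n. asymmetric_digraph G \<Longrightarrow>
      \<theta> G n \<in> linear_maps R (chains (F G) n) (chains (E G) n)"
    and surj: "\<And>G n. asymmetric_digraph G \<Longrightarrow>
      \<theta> G n ` carrier (chains (F G) n) = carrier (chains (E G) n)"
    and zero: "\<And>G n. asymmetric_digraph G \<Longrightarrow>
      \<theta> G n \<zero>\<^bsub>chains (F G) n\<^esub> = \<zero>\<^bsub>chains (E G) n\<^esub>"
    and diff: "\<And>G n x. \<lbrakk>asymmetric_digraph G; x \<in> carrier (chains (F G) n)\<rbrakk> \<Longrightarrow>
      diff (E G) n (\<theta> G n x) = \<theta> G (n - 1) (diff (F G) n x)"
    and map: "\<And>G H f n x. \<lbrakk>asymmetric_digraph G; asymmetric_digraph H; digraph_map G H f;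
      x \<in> carrier (chains (F G) n)\<rbrakk> \<Longrightarrow> E' G H f n (\<theta> G n x) = \<theta> H n (F' G H f n x)"
  shows "digraph_functor R E E'"
proof -
  have C: "module R (chains (F G) n)"
      "diff (F G) n \<in> linear_maps R (chains (F G) n) (chains (F G) (n - 1))"
      "x \<in> carrier (chains (F G) n) \<Longrightarrow> diff (F G) (n - 1) (diff (F G) n x) = \<zero>\<^bsub>chains (F G) (n - 2)\<^esub>"
    if "asymmetric_digraph G" for G n x
    using F that by (auto simp: digraph_functor_def chain_complex_def)
  have M: "F' G H f n \<in> linear_maps R (chains (F G) n) (chains (F H) n)"
      "x \<in> carrier (chains (F G) n) \<Longrightarrow> diff (F H) n (F' G H f n x) = F' G H f (n - 1) (diff (F G) n x)"
    if "asymmetric_digraph G" "asymmetric_digraph H" "digraph_map G H f" for G H f n x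
    using F that by (auto simp: digraph_functor_def chain_map_def)
  have lift: "P y" if "asymmetric_digraph G" "y \<in> carrier (chains (E G) n)"
    "\<And>x. x \<in> carrier (chains (F G) n) \<Longrightarrow> P (\<theta> G n x)" for P y G n
    using that surj by (metis imageE)
  have comp: "E' G K (g \<circ> f) n x = E' H K g n (E' G H f n x)"
    if G: "asymmetric_digraph G" and H: "asymmetric_digraph H" and K: "asymmetric_digraph K"
      and f: "digraph_map G H f" and g: "digraph_map H K g" and x: "x \<in> carrier (chains (E G) n)"
    for G H K f g n x
  proof (rule lift[OF G x])
    fix x assume x: "x \<in> carrier (chains (F G) n)"
    have gf: "digraph_map G K (g \<circ> f)"
      using f g by (fastforce simp: digraph_map_def)
    have "F' G K (g \<circ> f) n x = F' H K g n (F' G H f n x)"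
      using F G H K f g x unfolding digraph_functor_def by blast
    then show "E' G K (g \<circ> f) n (\<theta> G n x) = E' H K g n (E' G H f n (\<theta> G n x))"
      using map[OF G K gf x] map[OF G H f x] map[OF H K g linear_maps_closed[OF M(1)[OF G H f] x]]
      by simp
  qed
  have "chain_complex R (E G)" if G: "asymmetric_digraph G" for G
    unfolding chain_complex_def
  proof (intro conjI allI ballI)
    fix n
    show "module R (chains (E G) n)"
      by (rule module_linear_image[OF C(1) surj zero \<theta>]; fact G)
    show "diff (E G) n \<in> linear_maps R (chains (E G) n) (chains (E G) (n - 1))"
      by (rule linear_maps_transport[OF C(1)[OF G] C(2)[OF G] \<theta>[OF G] surj[OF G] \<theta>[OF G]
            diff[OF G]])
    show "diff (E G) (n - 1) (diff (E G) n x) = \<zero>\<^bsub>chains (E G) (n - 2)\<^esub>"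
      if x: "x \<in> carrier (chains (E G) n)" for x
    proof (rule lift[OF G x])
      show "diff (E G) (n - 1) (diff (E G) n (\<theta> G n x)) = \<zero>\<^bsub>chains (E G) (n - 2)\<^esub>"
        if x: "x \<in> carrier (chains (F G) n)" for x
        using diff[OF G x] diff[OF G linear_maps_closed[OF C(2)[OF G] x]] C(3)[OF G x]
          zero[OF G, of "n - 2"] by simp
    qed
  qed
  moreover have "chain_map R (E G) (E H) (E' G H f)"
    if G: "asymmetric_digraph G" and H: "asymmetric_digraph H" and f: "digraph_map G H f" for G H f
    unfolding chain_map_def
  proof (intro conjI allI ballI)
    fix n
    show "E' G H f n \<in> linear_maps R (chains (E G) n) (chains (E H) n)"
      by (rule linear_maps_transport[OF C(1)[OF G] M(1)[OF G H f] \<theta>[OF G] surj[OF G] \<theta>[OF H]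
            map[OF G H f]])
    show "diff (E H) n (E' G H f n x) = E' G H f (n - 1) (diff (E G) n x)"
      if x: "x \<in> carrier (chains (E G) n)" for x
    proof (rule lift[OF G x])
      show "diff (E H) n (E' G H f n (\<theta> G n x)) = E' G H f (n - 1) (diff (E G) n (\<theta> G n x))"
        if x: "x \<in> carrier (chains (F G) n)" for x
        using diff[OF G x] map[OF G H f x] map[OF G H f linear_maps_closed[OF C(2)[OF G] x]]
          diff[OF H linear_maps_closed[OF M(1)[OF G H f] x]] M(2)[OF G H f x] by simp
    qed
  qed
  moreover have "E' G G id n x = x"
    if G: "asymmetric_digraph G" and x: "x \<in> carrier (chains (E G) n)" for G n x
  proof (rule lift[OF G x])
    have "digraph_map G G id" by (auto simp: digraph_map_def)
    moreover have "F' G G id n x = x" if "x \<in> carrier (chains (F G) n)" for x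
      using F G that unfolding digraph_functor_def by blast
    ultimately show "E' G G id n (\<theta> G n x) = \<theta> G n x" if "x \<in> carrier (chains (F G) n)" for x
      using map[OF G G _ that, of id] that by simp
  qed
  ultimately show ?thesis
    using comp by (simp add: digraph_functor_def)
qed

section \<open>The class map modulo irregular paths\<close>

context cring
begin

lemma regular_class_linear:
  "regular_class R V n \<in> linear_maps R (path_module R V n) (regular_module R V n)"
  unfolding regular_module_def regular_class_def[abs_def]
  by (rule coset_linear[OF module_path_module submodule_irregular])

lemma regular_class_zero:
  "regular_class R V n \<zero>\<^bsub>path_module R V n\<^esub> = \<zero>\<^bsub>regular_module R V n\<^esub>"
proof -
  interpret M: module R "path_module R V n" by (rule module_path_module)
  show ?thesis
    using M.M.a_coset_add_zero[OF M.submoduleE(1)[OF submodule_irregular]]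
    by (simp add: regular_class_def regular_module_def quotient_module_def)
qed

text \<open>Equal classes give \<open>c\<close> as the pointwise sum of \<open>d\<close> and an
  irregular chain \<open>i\<close>; at regular paths \<open>i\<close> vanishes, and at all other
  lists \<open>c\<close> and \<open>d\<close> do.\<close>

lemma regular_class_inj:
  assumes c: "c \<in> carrier (free_module R (regular_paths V n))"
    and d: "d \<in> carrier (free_module R (regular_paths V n))"
    and eq: "regular_class R V n c = regular_class R V n d"
  shows "c = d"
proof -
  interpret M: module R "path_module R V n" by (rule module_path_module)
  have closed: "c \<in> carrier (path_module R V n)"
    using c free_module_carrier_mono[of "regular_paths V n" "elem_paths V n"]
    by (auto simp: path_module_def regular_paths_def)
  have "c \<in> regular_class R V n c"
    unfolding regular_class_def
    by (rule abelian_subgroup.a_rcos_self[OF M.abelian_subgroup_submodule[OF submodule_irregular] closed])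
  then have "c \<in> regular_class R V n d" using eq by simp
  then obtain i where i: "i \<in> irregular_submodule R V n" and "c = i \<oplus>\<^bsub>path_module R V n\<^esub> d"
    by (auto simp: regular_class_def a_r_coset_def')
  then have cd: "c p = i p \<oplus> d p" for p
    by (simp add: path_module_def free_module_def)
  have "c p = d p" for p
  proof (cases "p \<in> regular_paths V n")
    case True
    then have "i p = \<zero>"
      using i by (simp add: irregular_submodule_eq free_module_def irregular_paths_def regular_paths_def)
    moreover have "d p \<in> carrier R" using d by (auto simp: free_module_def)
    ultimately show ?thesis using cd[of p] by simp
  next
    case False
    then show ?thesis using c d by (simp add: free_module_def)
  qed
  then show ?thesis by (rule ext)
qed

lemma regular_boundary_class:
  "c \<in> carrier (path_module R V n) \<Longrightarrow>
    regular_boundary R V n (regular_class R V n c) = regular_class R V (n - 1) (boundary R V n c)"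
  unfolding regular_boundary_def regular_class_def
  by (intro quotient_map_coset[OF module_path_module module_path_module submodule_irregular
        submodule_irregular boundary_linear] boundary_irregular)

lemma Omega_map_class:
  assumes "f ` pverts G \<subseteq> pverts H" "c \<in> carrier (path_module R (pverts G) n)"
  shows "Omega_map R G H f n (regular_class R (pverts G) n c) =
    regular_class R (pverts H) n (Pi_map R G H f n c)"
  unfolding Omega_map_def regular_class_def
  by (intro quotient_map_coset[OF module_path_module module_path_module submodule_irregular
        submodule_irregular Pi_map_linear] Pi_map_irregular assms)

lemma Pi_carrier_allowed: "c \<in> Pi_carrier R G n \<Longrightarrow> c \<in> allowed_submodule R G n"
  by (simp add: Pi_carrier_def)

lemma allowed_closed: "c \<in> allowed_submodule R G n \<Longrightarrow> c \<in> carrier (path_module R (pverts G) n)"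
  using module.submoduleE(1)[OF module_path_module submodule_allowed] by blast

lemmas Pi_carrier_closed = allowed_closed[OF Pi_carrier_allowed]

lemma allowed_zero: "\<zero>\<^bsub>path_module R (pverts G) n\<^esub> \<in> allowed_submodule R G n"
  by (rule module.submodule_zero_closed[OF module_path_module submodule_allowed])

lemma submodule_Pi: "submodule (Pi_carrier R G n) R (path_module R (pverts G) n)"
proof -
  interpret M: module R "path_module R (pverts G) n" by (rule module_path_module)
  note A = module.submoduleE[OF module_path_module submodule_allowed]
  note lin = boundary_linear[of "pverts G" n]
  show ?thesis
  proof (rule M.submoduleI')
    show "\<zero>\<^bsub>path_module R (pverts G) n\<^esub> \<in> Pi_carrier R G n"
      using linear_maps_zero[OF module_path_module module_path_module lin]
      by (simp add: Pi_carrier_def allowed_zero)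
  qed (auto simp: Pi_carrier_closed Pi_carrier_def A(4,5) linear_maps_add[OF lin]
      linear_maps_smult[OF lin] allowed_closed)
qed

text \<open>The condition in degree \<open>n - 2\<close> holds because \<partial>\<partial> = 0 and
  zero is an allowed chain.\<close>

lemma boundary_Pi:
  assumes "c \<in> Pi_carrier R G n"
  shows "boundary R (pverts G) n c \<in> Pi_carrier R G (n - 1)"
  using assms boundary_boundary[OF Pi_carrier_closed[OF assms]] allowed_zero[of G "n - 2"]
  by (simp add: Pi_carrier_def)

lemma Pi_map_Pi:
  assumes "digraph_map G H f" "asym (parcs H)" "c \<in> Pi_carrier R G n"
  shows "Pi_map R G H f n c \<in> Pi_carrier R H n"
  using assms Pi_map_allowed[OF assms(1)] boundary_Pi_map[OF assms(1,2)]
  by (simp add: Pi_carrier_def)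

lemma allowed_regular_chain:
  assumes "asym (parcs G)" "c \<in> allowed_submodule R G n"
  shows "c \<in> carrier (free_module R (regular_paths (pverts G) n))"
  using assms(2) free_module_carrier_mono[OF allowed_regular[OF assms(1)]]
  by (auto simp: allowed_submodule_eq)

text \<open>If the boundary has the class of some allowed chain \<open>d\<close>, both are supported
  on regular paths and therefore equal, so the boundary itself is allowed. Asymmetry enters twice:
  for the regularity of the boundary and for that of \<open>d\<close>.\<close>

lemma Omega_carrier_eq:
  assumes "asym (parcs G)"
  shows "Omega_carrier R G n = regular_class R (pverts G) n ` Pi_carrier R G n"
proof -
  have "boundary R (pverts G) n c \<in> allowed_submodule R G (n - 1) \<longleftrightarrow>
      regular_boundary R (pverts G) n (regular_class R (pverts G) n c) \<in>
        regular_class R (pverts G) (n - 1) ` allowed_submodule R G (n - 1)"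
    if c: "c \<in> allowed_submodule R G n" for c
    unfolding regular_boundary_class[OF allowed_closed[OF c]]
    using regular_class_inj[OF boundary_allowed_regular[OF assms c] allowed_regular_chain[OF assms]]
    by auto
  then show ?thesis
    by (auto simp: Omega_carrier_def Pi_carrier_def)
qed

section \<open>Functoriality of Pi and the natural isomorphism\<close>

lemma Pi_functor: "digraph_functor R (Pi_complex R) (Pi_map R)"
  unfolding digraph_functor_def
proof (intro conjI allI impI ballI; (elim conjE)?)
  fix G :: "'v pair_pre_digraph"
  assume "asymmetric_digraph G"
  show "chain_complex R (Pi_complex R G)"
    unfolding chain_complex_def
  proof (intro conjI allI ballI)
    fix n
    show "module R (chains (Pi_complex R G) n)"
      using submodule.submodule_is_module[OF submodule_Pi module_path_module]
      by (simp add: Pi_complex_def)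
    show "diff (Pi_complex R G) n \<in>
        linear_maps R (chains (Pi_complex R G) n) (chains (Pi_complex R G) (n - 1))"
      unfolding Pi_complex_def complex_data.simps
      by (intro linear_maps_restrict[OF boundary_linear] subsetI Pi_carrier_closed boundary_Pi)
    show "diff (Pi_complex R G) (n - 1) (diff (Pi_complex R G) n c) = \<zero>\<^bsub>chains (Pi_complex R G) (n - 2)\<^esub>"
      if "c \<in> carrier (chains (Pi_complex R G) n)" for c
      using that boundary_boundary[OF Pi_carrier_closed[of c G n]] by (simp add: Pi_complex_def)
  qed
next
  fix G H :: "'v pair_pre_digraph" and f
  assume "asymmetric_digraph G" and H: "asymmetric_digraph H" and f: "digraph_map G H f"
  have f': "f ` pverts G \<subseteq> pverts H" and asym: "asym (parcs H)"
    using f H by (auto simp: digraph_map_def asymmetric_digraph_def)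
  show "chain_map R (Pi_complex R G) (Pi_complex R H) (Pi_map R G H f)"
    unfolding chain_map_def
  proof (intro conjI allI ballI)
    fix n
    show "Pi_map R G H f n \<in> linear_maps R (chains (Pi_complex R G) n) (chains (Pi_complex R H) n)"
      unfolding Pi_complex_def complex_data.simps
      by (intro linear_maps_restrict[OF Pi_map_linear[OF f']] subsetI Pi_carrier_closed
          Pi_map_Pi[OF f asym])
    show "diff (Pi_complex R H) n (Pi_map R G H f n c) = Pi_map R G H f (n - 1) (diff (Pi_complex R G) n c)"
      if "c \<in> carrier (chains (Pi_complex R G) n)" for c
      using that boundary_Pi_map[OF f asym Pi_carrier_allowed[of c G n]] by (simp add: Pi_complex_def)
  qed
next
  fix G :: "'v pair_pre_digraph" and n c
  assume "asymmetric_digraph G" and "c \<in> carrier (chains (Pi_complex R G) n)"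
  then show "Pi_map R G G id n c = c"
    using Pi_map_id[OF _ Pi_carrier_allowed[of c G n]] by (simp add: Pi_complex_def asymmetric_digraph_def)
next
  fix G H K :: "'v pair_pre_digraph" and f g n c
  assume "digraph_map G H f" "digraph_map H K g" "c \<in> carrier (chains (Pi_complex R G) n)"
  then show "Pi_map R G K (g \<circ> f) n c = Pi_map R H K g n (Pi_map R G H f n c)"
    using Pi_map_comp[of f G H g K c n] Pi_carrier_closed[of c G n]
    by (simp add: Pi_complex_def digraph_map_def)
qed

lemma regular_class_chain_maps:
  assumes G: "asymmetric_digraph G"
  shows "regular_class R (pverts G) n \<in>
      linear_maps R (chains (Pi_complex R G) n) (chains (Omega_complex R G) n)"
    and "bij_betw (regular_class R (pverts G) n) (carrier (chains (Pi_complex R G) n))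
      (carrier (chains (Omega_complex R G) n))"
    and "c \<in> carrier (chains (Pi_complex R G) n) \<Longrightarrow>
      diff (Omega_complex R G) n (regular_class R (pverts G) n c) =
      regular_class R (pverts G) (n - 1) (diff (Pi_complex R G) n c)"
proof -
  have asym: "asym (parcs G)" using G by (simp add: asymmetric_digraph_def)
  show "regular_class R (pverts G) n \<in>
      linear_maps R (chains (Pi_complex R G) n) (chains (Omega_complex R G) n)"
    unfolding Pi_complex_def Omega_complex_def complex_data.simps Omega_carrier_eq[OF asym]
    by (intro linear_maps_restrict[OF regular_class_linear] subsetI Pi_carrier_closed imageI)
  have "inj_on (regular_class R (pverts G) n) (Pi_carrier R G n)"
    by (intro inj_onI)
      (rule regular_class_inj[OF allowed_regular_chain[OF asym Pi_carrier_allowed]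
          allowed_regular_chain[OF asym Pi_carrier_allowed]])
  then show "bij_betw (regular_class R (pverts G) n) (carrier (chains (Pi_complex R G) n))
      (carrier (chains (Omega_complex R G) n))"
    by (simp add: Pi_complex_def Omega_complex_def Omega_carrier_eq[OF asym] bij_betw_def)
  show "diff (Omega_complex R G) n (regular_class R (pverts G) n c) =
      regular_class R (pverts G) (n - 1) (diff (Pi_complex R G) n c)"
    if "c \<in> carrier (chains (Pi_complex R G) n)"
    using that regular_boundary_class[OF Pi_carrier_closed[of c G n]]
    by (simp add: Pi_complex_def Omega_complex_def)
qed

end

theorem theorem3p7:
  fixes R :: "('r, 'x) ring_scheme"
  assumes "cring R"
  shows "naturally_isomorphic R
    (Pi_complex R :: 'v pair_pre_digraph \<Rightarrow> _) (Pi_map R)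
    (Omega_complex R) (Omega_map R)"
proof -
  interpret cring R by fact
  let ?\<theta> = "\<lambda>(G :: 'v pair_pre_digraph) n. regular_class R (pverts G) n"
  note classes = regular_class_chain_maps
  \<comment> \<open>Naturality comes before functoriality of Omega: it follows from the formula for
    \<open>Omega_map\<close> on classes and is itself an input of the transport.\<close>
  have nat: "Omega_map R G H f n (?\<theta> G n c) = ?\<theta> H n (Pi_map R G H f n c)"
    if "digraph_map G H f" "c \<in> carrier (chains (Pi_complex R G) n)" for G H f n c
    using that Omega_map_class[OF _ Pi_carrier_closed[of c G n]] by (simp add: digraph_map_def Pi_complex_def)
  have "digraph_functor R (Omega_complex R :: 'v pair_pre_digraph \<Rightarrow> _) (Omega_map R)"
  proof (rule digraph_functor_transport[OF Pi_functor, where \<theta> = ?\<theta>])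
    show "?\<theta> G n ` carrier (chains (Pi_complex R G) n) = carrier (chains (Omega_complex R G) n)"
      if "asymmetric_digraph G" for G n
      using classes(2)[OF that] by (simp add: bij_betw_def)
    show "?\<theta> G n \<zero>\<^bsub>chains (Pi_complex R G) n\<^esub> = \<zero>\<^bsub>chains (Omega_complex R G) n\<^esub>" for G n
      by (simp add: Pi_complex_def Omega_complex_def regular_class_zero)
    show "Omega_map R G H f n (?\<theta> G n c) = ?\<theta> H n (Pi_map R G H f n c)"
      if "digraph_map G H f" "c \<in> carrier (chains (Pi_complex R G) n)" for G H f n c
      using that by (rule nat)
  qed (fact classes(1) classes(3))+
  moreover have "chain_isomorphism R (Pi_complex R G) (Omega_complex R G) (?\<theta> G)"
    if "asymmetric_digraph G" for G
    using classes[OF that] by (simp add: chain_isomorphism_def chain_map_def)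
  ultimately show ?thesis
    unfolding naturally_isomorphic_def using Pi_functor nat
    by (intro conjI exI[of _ ?\<theta>]) auto
qed

end
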